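(* Let $n\ge3$, $t_1<\dots<t_n$, and for $j=1,\dots,n-1$ let $\lambda_{0,j}<0<\lambda_{1,j}$ be real and $\varphi_j=\Phi_{(\lambda_{0,j},\lambda_{1,j})}$. Let $H_1,\dots,H_n$ be the associated generalized hat functions and $\mathcal{H}_n$ their span. Then the matrix $(s_{i,j})$ with $s_{i,j}=\int_{t_1}^{t_n}H_iH_j\,dt$ is row diagonally dominant and $$\|P^{\mathcal{H}_n}\|_{op}\le2\max_{1\le j\le n-1}\max\left\{\frac{2\lambda_{1,j}-4\lambda_{0,j}}{-3\lambda_{0,j}},\frac{4\lambda_{1,j}-2\lambda_{0,j}}{3\lambda_{1,j}}\right\},$$ where $P^{\mathcal{H}_n}$ is the orthogonal projection onto $\mathcal{H}_n$ for the unweighted $L^2$ inner product on $[t_1,t_n]$.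
   Context: $\Phi_{(\lambda_0,\lambda_1)}(t)=\frac{e^{\lambda_1t}-e^{\lambda_0t}}{\lambda_1-\lambda_0}$ ($\lambda_0\ne\lambda_1$). Generalized hat functions: for $2\le j\le n-1$, $H_j(t)=\frac{\varphi_{j-1}(t-t_{j-1})}{\varphi_{j-1}(t_j-t_{j-1})}$ on $[t_{j-1},t_j]$, $H_j(t)=\frac{\varphi_j(t-t_{j+1})}{\varphi_j(t_j-t_{j+1})}$ on $[t_j,t_{j+1}]$, $0$ elsewhere; $H_1=\frac{\varphi_1(t-t_2)}{\varphi_1(t_1-t_2)}$ on $[t_1,t_2]$, $0$ elsewhere; $H_n=\frac{\varphi_{n-1}(t-t_{n-1})}{\varphi_{n-1}(t_n-t_{n-1})}$ on $[t_{n-1},t_n]$, $0$ elsewhere. $\|P^{\mathcal{H}_n}\|_{op}=\sup_{f\ne0}\|P^{\mathcal{H}_n}f\|_\infty/\|f\|_\infty$ on $C[t_1,t_n]$. Row diagonally dominant: there is $c\in(0,1)$ with $|s_{j-1,j}|+|s_{j,j+1}|\le c|s_{j,j}|$ for all $j$, where $s_{0,1}=s_{n,n+1}=0$. *)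

theory Defs
  imports "HOL-Analysis.Analysis"
begin

definition Phi :: "real \<Rightarrow> real \<Rightarrow> real \<Rightarrow> real" where
  "Phi l0 l1 x = (exp (l1 * x) - exp (l0 * x)) / (l1 - l0)"

text \<open>Generalized hat functions H_j, j = 1..n, with nodes t 1 < ... < t n and
  phi_j = Phi (l0 j) (l1 j) for j = 1..n-1. Indices outside 1..n give the zero function.\<close>
definition hat :: "nat \<Rightarrow> (nat \<Rightarrow> real) \<Rightarrow> (nat \<Rightarrow> real) \<Rightarrow> (nat \<Rightarrow> real) \<Rightarrow> nat \<Rightarrow> real \<Rightarrow> real" where
  "hat n t l0 l1 j x =
    (let phi = (\<lambda>k. Phi (l0 k) (l1 k)) in
     if j = 1 then
       (if t 1 \<le> x \<and> x \<le> t 2 then phi 1 (x - t 2) / phi 1 (t 1 - t 2) else 0)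
     else if j = n then
       (if t (n - 1) \<le> x \<and> x \<le> t n then phi (n - 1) (x - t (n - 1)) / phi (n - 1) (t n - t (n - 1)) else 0)
     else if 2 \<le> j \<and> j \<le> n - 1 then
       (if t (j - 1) \<le> x \<and> x \<le> t j then phi (j - 1) (x - t (j - 1)) / phi (j - 1) (t j - t (j - 1))
        else if t j \<le> x \<and> x \<le> t (j + 1) then phi j (x - t (j + 1)) / phi j (t j - t (j + 1))
        else 0)
     else 0)"

definition gram :: "nat \<Rightarrow> (nat \<Rightarrow> real) \<Rightarrow> (nat \<Rightarrow> real) \<Rightarrow> (nat \<Rightarrow> real) \<Rightarrow> nat \<Rightarrow> nat \<Rightarrow> real" where
  "gram n t l0 l1 i j = integral {t 1 .. t n} (\<lambda>x. hat n t l0 l1 i x * hat n t l0 l1 j x)"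

text \<open>Row diagonal dominance of an n x n matrix (indices 1..n), with s_{0,1} = s_{n,n+1} = 0.\<close>
definition row_diag_dominant :: "(nat \<Rightarrow> nat \<Rightarrow> real) \<Rightarrow> nat \<Rightarrow> bool" where
  "row_diag_dominant s n \<longleftrightarrow> (\<exists>c. 0 < c \<and> c < 1 \<and>
     (\<forall>j\<in>{1..n}. (if j = 1 then 0 else \<bar>s (j - 1) j\<bar>) + (if j = n then 0 else \<bar>s j (j + 1)\<bar>)
                    \<le> c * \<bar>s j j\<bar>))"

definition hat_span :: "nat \<Rightarrow> (nat \<Rightarrow> real) \<Rightarrow> (nat \<Rightarrow> real) \<Rightarrow> (nat \<Rightarrow> real) \<Rightarrow> (real \<Rightarrow> real) set" where
  "hat_span n t l0 l1 = {(\<lambda>x. \<Sum>i=1..n. c i * hat n t l0 l1 i x) | c. True}"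

definition hat_proj :: "nat \<Rightarrow> (nat \<Rightarrow> real) \<Rightarrow> (nat \<Rightarrow> real) \<Rightarrow> (nat \<Rightarrow> real) \<Rightarrow> (real \<Rightarrow> real) \<Rightarrow> real \<Rightarrow> real" where
  "hat_proj n t l0 l1 f = (THE g. g \<in> hat_span n t l0 l1 \<and>
     (\<forall>i\<in>{1..n}. integral {t 1 .. t n} (\<lambda>x. (f x - g x) * hat n t l0 l1 i x) = 0))"

end

(* On a single interval let R and F be the rising and the falling part of the hat functions.
   Reflection of the interval exchanges R and F and replaces (l0, l1) by (- l1, - l0), so it is
   enough to estimate integrals of R. The three facts needed are: R + F <= 1; the integral of R is
   at most twice that of R^2; and the integral of R F is at most (1 - 1/kappa) times that of R^2,
   where kappa is the inner maximum in the bound. The last one is an inequality between functions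
   of the interval length, reduced by repeated differentiation to an inequality between
   exponentials.

   The third fact gives diagonal dominance with constant 1 - 1/K, where K is the maximum of the
   kappas. If P f has coefficients c_j, test orthogonality of f - P f against the hat function H_i
   with |c_i| maximal: the three facts yield |c_i| <= 2 K sup |f|, and R + F <= 1 transfers this to
   the sup norm of P f. The same estimate with f = 0 makes P f unique, and hence existent. *)

theory Submission
  imports Defs
begin

section \<open>Calculus of the functions \<open>Phi\<close> and inequalities for their
  integrals\<close>

text \<open>Derivatives are taken within the interval because the fundamental theorem of calculus
  supplies them in this form for integrals from 0. The proof itself needs only interior derivatives
  and continuity up to the ends.\<close>

lemma nonneg_if_deriv_nonneg:
  fixes f f' :: "real \<Rightarrow> real"
  assumes d: "\<And>x. 0 \<le> x \<Longrightarrow> x \<le> T \<Longrightarrow> (f has_real_derivative f' x) (at x within {0..T})"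
    and nn: "\<And>x. 0 \<le> x \<Longrightarrow> x \<le> T \<Longrightarrow> 0 \<le> f' x"
    and 0: "0 \<le> f 0" and x: "0 \<le> x" "x \<le> T"
  shows "0 \<le> f x"
proof -
  have "f 0 \<le> f x"
  proof (rule DERIV_nonneg_imp_increasing_open[OF x(1)])
    fix y assume y: "0 < y" "y < x"
    then have "(f has_real_derivative f' y) (at y)"
      using d[of y] x at_within_Icc_at[of 0 y T] by auto
    then show "\<exists>z. (f has_real_derivative z) (at y) \<and> 0 \<le> z"
      using nn[of y] y x by auto
  next
    have "continuous_on {0..T} f"
      using d by (meson DERIV_continuous_on atLeastAtMost_iff)
    then show "continuous_on {0..x} f"
      using x by (auto intro: continuous_on_subset)
  qed
  with 0 show ?thesis by simp
qed

lemma Phi_0 [simp]: "Phi l0 l1 0 = 0"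
  by (simp add: Phi_def)

lemma Phi_pos:
  assumes "l0 < l1" "0 < x"
  shows "0 < Phi l0 l1 x"
  using assms by (simp add: Phi_def)

lemma Phi_nonneg:
  assumes "l0 < l1" "0 \<le> x"
  shows "0 \<le> Phi l0 l1 x"
  using assms by (simp add: Phi_def divide_nonneg_pos mult_right_mono)

text \<open>The source of the symmetry between rising and falling parts: the sign condition
  \<open>l0 < 0 < l1\<close> is preserved by passing to \<open>(- l1, - l0)\<close>.\<close>

lemma Phi_reflect: "Phi l0 l1 (- x) = - Phi (- l1) (- l0) x"
  by (simp add: Phi_def divide_simps)

lemma continuous_on_Phi [continuous_intros]:
  "continuous_on S f \<Longrightarrow> continuous_on S (\<lambda>x. Phi l0 l1 (f x))"
  unfolding Phi_def divide_inverse by (intro continuous_intros)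

lemma Phi_has_derivative:
  "(Phi l0 l1 has_real_derivative (l1 * exp (l1 * x) - l0 * exp (l0 * x)) / (l1 - l0)) (at x within S)"
  unfolding Phi_def[abs_def]
  by (intro DERIV_cdivide) (auto intro!: derivative_eq_intros)

text \<open>Differentiating twice in \<open>h\<close> reduces the claim to log-concavity of the positive function
  \<open>Phi l0 l1\<close>, which holds because its Wronskian is an exponential.\<close>

lemma Phi_integral_le_twice_square:
  assumes l: "l0 < 0" "0 < l1" and h: "0 \<le> h"
  shows "Phi l0 l1 h * integral {0..h} (Phi l0 l1) \<le> 2 * integral {0..h} (\<lambda>x. (Phi l0 l1 x)\<^sup>2)"
proof -
  define p where "p = Phi l0 l1"
  define p' where "p' x = (l1 * exp (l1 * x) - l0 * exp (l0 * x)) / (l1 - l0)" for x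
  define p'' where "p'' x = (l1\<^sup>2 * exp (l1 * x) - l0\<^sup>2 * exp (l0 * x)) / (l1 - l0)" for x
  define P where "P x = integral {0..x} p" for x
  define J where "J x = integral {0..x} (\<lambda>x. (p x)\<^sup>2)" for x
  have [derivative_intros]: "(p has_real_derivative p' x) (at x within S)" for x S
    unfolding p_def p'_def by (rule Phi_has_derivative)
  have [derivative_intros]: "(p' has_real_derivative p'' x) (at x within S)" for x S
    unfolding p'_def[abs_def] p''_def
    by (intro DERIV_cdivide) (auto intro!: derivative_eq_intros simp: power2_eq_square)
  have pc: "continuous_on S p" for S
    unfolding p_def by (intro continuous_intros)
  have P': "(P has_real_derivative p x) (at x within {0..h})" if "0 \<le> x" "x \<le> h" for x
    unfolding P_def[abs_def] using that by (intro integral_has_real_derivative pc) auto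
  have J': "(J has_real_derivative (p x)\<^sup>2) (at x within {0..h})" if "0 \<le> x" "x \<le> h" for x
    unfolding J_def[abs_def] using that
    by (intro integral_has_real_derivative[where g = "\<lambda>x. (p x)\<^sup>2"] continuous_intros pc) auto
  have p'pos: "0 < p' x" for x
    unfolding p'_def using l
    by (intro divide_pos_pos) (auto intro!: add_pos_pos simp: mult_neg_pos diff_gt_0_iff_gt intro: less_trans[of _ 0])
  have p0: "0 \<le> p x" if "0 \<le> x" for x
    using that l by (simp add: p_def Phi_nonneg)
  have wronskian: "(p' x)\<^sup>2 - p x * p'' x = exp (l1 * x) * exp (l0 * x)" for x
  proof -
    have "(l1 - l0)\<^sup>2 * ((p' x)\<^sup>2 - p x * p'' x) =
       (l1 * exp (l1 * x) - l0 * exp (l0 * x))\<^sup>2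
       - (exp (l1 * x) - exp (l0 * x)) * (l1\<^sup>2 * exp (l1 * x) - l0\<^sup>2 * exp (l0 * x))"
    proof -
      have *: "d\<^sup>2 * ((A / d)\<^sup>2 - B / d * (C / d)) = A\<^sup>2 - B * C" if "d \<noteq> 0" for A B C d :: real
        using that by (simp add: field_simps power2_eq_square)
      show ?thesis unfolding p_def Phi_def p'_def p''_def using l by (intro *) simp
    qed
    also have "\<dots> = (l1 - l0)\<^sup>2 * (exp (l1 * x) * exp (l0 * x))" by algebra
    finally show ?thesis using l by simp
  qed
  \<comment> \<open>The derivative of \<open>2 * J - p * P\<close> is
    \<open>(p x)\<^sup>2 - p' x * P x\<close>. Dividing it by \<open>p'\<close> isolates the
    integral \<open>P\<close>, and the quotient then has derivative \<open>p\<close> times the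
    Wronskian over the square of \<open>p'\<close>.\<close>
  have G: "0 \<le> (p x)\<^sup>2 / p' x - P x" if x: "0 \<le> x" "x \<le> h" for x
  proof (rule nonneg_if_deriv_nonneg[of h "\<lambda>x. (p x)\<^sup>2 / p' x - P x" "\<lambda>x. p x * (((p' x)\<^sup>2 - p x * p'' x) / (p' x)\<^sup>2)"])
    fix y assume y: "0 \<le> y" "y \<le> h"
    show "((\<lambda>x. (p x)\<^sup>2 / p' x - P x) has_real_derivative p y * (((p' y)\<^sup>2 - p y * p'' y) / (p' y)\<^sup>2)) (at y within {0..h})"
      using p'pos[of y]
      by (auto intro!: derivative_eq_intros P' y) (simp add: field_simps power2_eq_square)
    show "0 \<le> p y * (((p' y)\<^sup>2 - p y * p'' y) / (p' y)\<^sup>2)"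
      unfolding wronskian using p0[OF y(1)] by simp
  qed (use x in \<open>auto simp: p_def P_def\<close>)
  have "0 \<le> 2 * J h - p h * P h"
  proof (rule nonneg_if_deriv_nonneg[of h "\<lambda>x. 2 * J x - p x * P x" "\<lambda>x. (p x)\<^sup>2 - p' x * P x"])
    fix y assume y: "0 \<le> y" "y \<le> h"
    show "((\<lambda>x. 2 * J x - p x * P x) has_real_derivative (p y)\<^sup>2 - p' y * P y) (at y within {0..h})"
      by (auto intro!: derivative_eq_intros P' J' y) (simp add: power2_eq_square)
    show "0 \<le> (p y)\<^sup>2 - p' y * P y"
      using G[OF y] p'pos[of y] by (simp add: field_simps)
  qed (use h in \<open>auto simp: J_def P_def\<close>)
  then show ?thesis by (simp add: J_def P_def p_def)
qed

text \<open>With \<open>b\<close> and \<open>- a\<close> the exponents of \<open>Phi (- a) b\<close>, the difference \<open>D\<close> of the two sides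
  (up to a positive factor) satisfies \<open>E = D' + a * D\<close> and \<open>M = E' - b * E\<close>, and all three functions
  vanish at 0. Hypothesis \<open>quad\<close> says that \<open>M\<close> is increasing.\<close>

lemma Phi_convolution_le:
  fixes a b c h :: real
  assumes ab: "0 < a" "0 < b" and h: "0 \<le> h"
    and quad: "\<And>x. 0 \<le> x \<Longrightarrow>
      (a + b) * (exp (b * x) * exp (- a * x)) * ((2 * b - a) * exp (b * x) + (2 * a - b) * exp (- a * x))
      \<le> c * (2 * (b * exp (b * x) + a * exp (- a * x))\<^sup>2 + a * b * (exp (b * x) - exp (- a * x))\<^sup>2)"
  shows "Phi (- a) b h * integral {0..h} (\<lambda>x. Phi (- a) b x * Phi (- b) a (h - x))
    \<le> c * Phi (- b) a h * integral {0..h} (\<lambda>x. (Phi (- a) b x)\<^sup>2)"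
proof -
  define s where "s = a + b"
  have s: "0 < s" using ab by (simp add: s_def)
  define u where "u x = exp (b * x)" for x
  define v where "v x = exp (- a * x)" for x
  define p where "p = Phi (- a) b"
  have p_eq: "p x = (u x - v x) / s" for x
    by (simp add: p_def Phi_def u_def v_def s_def add.commute)
  have uv_pos: "0 < u x" "0 < v x" for x by (simp_all add: u_def v_def)
  have uv0: "u 0 = 1" "v 0 = 1" by (simp_all add: u_def v_def)
  have [derivative_intros]: "(u has_real_derivative b * u x) (at x within S)" for x S
    unfolding u_def[abs_def] by (auto intro!: derivative_eq_intros)
  have [derivative_intros]: "(v has_real_derivative - a * v x) (at x within S)" for x S
    unfolding v_def[abs_def] by (auto intro!: derivative_eq_intros)
  have [derivative_intros]: "(p has_real_derivative (b * u x + a * v x) / s) (at x within S)" for x S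
    unfolding p_eq[abs_def] using s by (auto intro!: derivative_eq_intros)
  have pc: "continuous_on S p" for S
    unfolding p_def by (intro continuous_intros)
  have uc: "continuous_on S u" for S
    unfolding u_def[abs_def] by (intro continuous_intros)
  have vc: "continuous_on S v" for S
    unfolding v_def[abs_def] by (intro continuous_intros)
  define J where "J x = integral {0..x} (\<lambda>x. (p x)\<^sup>2)" for x
  define U where "U x = integral {0..x} (\<lambda>x. p x * v x)" for x
  define V where "V x = integral {0..x} (\<lambda>x. p x * u x)" for x
  have J': "(J has_real_derivative (p x)\<^sup>2) (at x within {0..h})" if "0 \<le> x" "x \<le> h" for x
    unfolding J_def[abs_def] using that
    by (intro integral_has_real_derivative[where g = "\<lambda>x. (p x)\<^sup>2"] continuous_intros pc) auto
  have U': "(U has_real_derivative p x * v x) (at x within {0..h})" if "0 \<le> x" "x \<le> h" for x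
    unfolding U_def[abs_def] using that
    by (intro integral_has_real_derivative[where g = "\<lambda>x. p x * v x"] continuous_intros pc vc) auto
  have V': "(V has_real_derivative p x * u x) (at x within {0..h})" if "0 \<le> x" "x \<le> h" for x
    unfolding V_def[abs_def] using that
    by (intro integral_has_real_derivative[where g = "\<lambda>x. p x * u x"] continuous_intros pc uc) auto
  have zero: "J 0 = 0" "U 0 = 0" "V 0 = 0" "p 0 = 0" by (simp_all add: J_def U_def V_def p_def)
  define M where "M x = 2 * c * p x * ((b * u x + a * v x) / s) - c * (b - a) * (p x)\<^sup>2
      - a * b * c * J x - p x * (u x * v x)" for x
  define E where "E x = c * (p x)\<^sup>2 + a * c * J x - u x * U x" for x
  define D where "D x = c * J x - (u x * U x - v x * V x) / s" for x
  have M: "0 \<le> M x" if x: "0 \<le> x" "x \<le> h" for x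
  proof (rule nonneg_if_deriv_nonneg[of h M "\<lambda>x. (c * (2 * (b * u x + a * v x)\<^sup>2 + a * b * (u x - v x)\<^sup>2)
       - s * (u x * v x) * ((2 * b - a) * u x + (2 * a - b) * v x)) / s\<^sup>2"])
    fix y assume y: "0 \<le> y" "y \<le> h"
    \<comment> \<open>Differentiating \<open>M\<close> removes its only integral, \<open>J\<close>;
      after multiplication by the square of \<open>s\<close> the derivative is exactly the
      difference of the two sides of \<open>quad\<close>.\<close>
    have *: "s\<^sup>2 * (2 * c * (((b * u y + a * v y) / s)\<^sup>2 + p y * ((b\<^sup>2 * u y - a\<^sup>2 * v y) / s))
        - 2 * c * (b - a) * p y * ((b * u y + a * v y) / s) - a * b * c * (p y)\<^sup>2
        - (((b * u y + a * v y) / s) * (u y * v y) + p y * ((b - a) * (u y * v y))))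
      = c * (2 * (b * u y + a * v y)\<^sup>2 + a * b * (u y - v y)\<^sup>2)
       - s * (u y * v y) * ((2 * b - a) * u y + (2 * a - b) * v y)" (is "s\<^sup>2 * ?d = _")
      unfolding p_eq using s by (simp add: field_simps power2_eq_square)
    have "(M has_real_derivative ?d) (at y within {0..h})"
      unfolding M_def[abs_def] using s
      by (auto intro!: derivative_eq_intros J' y) (simp add: field_simps power2_eq_square)
    then show "(M has_real_derivative (c * (2 * (b * u y + a * v y)\<^sup>2 + a * b * (u y - v y)\<^sup>2)
       - s * (u y * v y) * ((2 * b - a) * u y + (2 * a - b) * v y)) / s\<^sup>2) (at y within {0..h})"
      unfolding *[symmetric] using s by simp
    show "0 \<le> (c * (2 * (b * u y + a * v y)\<^sup>2 + a * b * (u y - v y)\<^sup>2)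
       - s * (u y * v y) * ((2 * b - a) * u y + (2 * a - b) * v y)) / s\<^sup>2"
      using quad[OF y(1)] by (simp add: u_def v_def s_def)
  qed (use x zero in \<open>auto simp: M_def\<close>)
  have E: "0 \<le> E x" if x: "0 \<le> x" "x \<le> h" for x
  proof -
    \<comment> \<open>\<open>1 / u\<close> is the integrating factor for \<open>E' - b * E\<close>,
      so the quotient has derivative \<open>M / u\<close>. In the same way \<open>1 / v\<close>
      serves for \<open>D' + a * D\<close> below.\<close>
    have "0 \<le> E x / u x"
    proof (rule nonneg_if_deriv_nonneg[of h "\<lambda>x. E x / u x" "\<lambda>x. M x / u x"])
      fix y assume y: "0 \<le> y" "y \<le> h"
      show "((\<lambda>x. E x / u x) has_real_derivative M y / u y) (at y within {0..h})"
        unfolding E_def[abs_def] M_def using s uv_pos(1)[of y]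
        by (auto intro!: derivative_eq_intros J' U' y) (simp add: field_simps power2_eq_square)
      show "0 \<le> M y / u y" using M[OF y] uv_pos(1)[of y] by simp
    qed (use x zero in \<open>auto simp: E_def\<close>)
    then show ?thesis using uv_pos(1)[of x] by (simp add: zero_le_divide_iff)
  qed
  have D: "0 \<le> D h"
  proof -
    have "0 \<le> D h / v h"
    proof (rule nonneg_if_deriv_nonneg[of h "\<lambda>x. D x / v x" "\<lambda>x. E x / v x"])
      fix y assume y: "0 \<le> y" "y \<le> h"
      show "((\<lambda>x. D x / v x) has_real_derivative E y / v y) (at y within {0..h})"
        (is "(?f has_real_derivative _) _")
      proof -
        have "(D has_real_derivative c * (p y)\<^sup>2 - (b * u y * U y + a * v y * V y) / s) (at y within {0..h})"
          unfolding D_def[abs_def] using s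
          by (auto intro!: derivative_eq_intros J' U' V' y)
        then have "(?f has_real_derivative
            ((c * (p y)\<^sup>2 - (b * u y * U y + a * v y * V y) / s) + a * D y) / v y) (at y within {0..h})"
          using uv_pos(2)[of y]
          by (auto intro!: derivative_eq_intros simp: field_simps power2_eq_square)
        also have "(c * (p y)\<^sup>2 - (b * u y * U y + a * v y * V y) / s) + a * D y
          = c * (p y)\<^sup>2 + a * c * J y - (s * u y * U y) / s"
          unfolding D_def by (simp add: s_def algebra_simps add_divide_distrib diff_divide_distrib)
        finally show ?thesis using s by (simp add: E_def)
      qed
      show "0 \<le> E y / v y" using E[OF y] uv_pos(2)[of y] by simp
    qed (use h zero in \<open>auto simp: D_def\<close>)
    then show ?thesis using uv_pos(2)[of h] by (simp add: zero_le_divide_iff)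
  qed
  \<comment> \<open>Each exponential in the reflected factor splits into one in \<open>x\<close> and
    one in \<open>h\<close>. The convolution thus becomes a combination of \<open>U h\<close> and
    \<open>V h\<close>, integrals whose integrands do not involve \<open>h\<close>.\<close>
  have eq: "Phi (- b) a (h - x) = (v x / v h - u x / u h) / s" for x
    by (simp add: Phi_def u_def v_def s_def algebra_simps flip: exp_diff)
  have "integral {0..h} (\<lambda>x. p x * Phi (- b) a (h - x))
     = integral {0..h} (\<lambda>x. (1 / (s * v h)) * (p x * v x) - (1 / (s * u h)) * (p x * u x))"
    using s uv_pos[of h] by (intro integral_cong) (simp add: eq field_simps)
  also have "\<dots> = 1 / (s * v h) * U h - 1 / (s * u h) * V h"
    unfolding U_def V_def
    by (subst integral_diff)
       (use s uv_pos[of h] in \<open>auto intro!: integrable_continuous_real continuous_intros pc uc vc\<close>)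
  finally have I: "integral {0..h} (\<lambda>x. p x * Phi (- b) a (h - x)) = (u h * U h - v h * V h) / s / (u h * v h)"
    using s uv_pos[of h] by (simp add: field_simps)
  have psi: "Phi (- b) a h = p h / (u h * v h)"
    using eq[of 0] s uv_pos[of h] by (simp add: p_eq uv0 field_simps)
  have "0 \<le> p h" using ab h by (simp add: p_def Phi_nonneg)
  \<comment> \<open>The claim is \<open>0 \<le> D h\<close> up to this common factor, which by
    \<open>psi\<close> is \<open>Phi (- b) a h\<close>.\<close>
  then have "p h / (u h * v h) * ((u h * U h - v h * V h) / s) \<le> p h / (u h * v h) * (c * J h)"
    using D uv_pos[of h] by (intro mult_left_mono) (auto simp: D_def)
  then show ?thesis unfolding p_def[symmetric] I psi J_def
    by (simp only: times_divide_eq_left times_divide_eq_right divide_divide_eq_left mult_ac)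
qed

text \<open>Dividing by the product of the exponentials turns the claim into positivity of an exponential
  sum \<open>N\<close> whose third derivative is nonnegative, so \<open>N\<close> dominates its quadratic Taylor polynomial
  at 0, which is nonnegative.\<close>

lemma quad_exp_ge:
  fixes a b x :: real
  assumes ab: "0 < a" "a \<le> b" and x: "0 \<le> x"
  shows "2 * (b + 2 * a) * (a + b) * (exp (b * x) * exp (- a * x)) * ((2 * b - a) * exp (b * x) + (2 * a - b) * exp (- a * x))
      \<le> (2 * b + a) * (2 * (b * exp (b * x) + a * exp (- a * x))\<^sup>2 + a * b * (exp (b * x) - exp (- a * x))\<^sup>2)"
proof -
  define s where "s = a + b"
  have b: "0 < b" using ab by simp
  have s: "0 < s" using ab by (simp add: s_def)
  \<comment> \<open>These are the coefficients left after expanding both sides and dividing by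
    \<open>exp (b * x) * exp (- a * x)\<close>: the squares yield \<open>exp (s * x)\<close> and
    \<open>exp (- s * x)\<close>, the mixed term a constant, and the left side yields
    \<open>C1\<close> and \<open>C2\<close>.\<close>
  define A B C1 C2 where "A = (2 * b + a) * (b * (2 * b + a))" and "B = (2 * b + a) * (a * (2 * a + b))"
    and "C1 = 2 * (b + 2 * a) * s * (2 * b - a)" and "C2 = 2 * (b + 2 * a) * s * (2 * a - b)"
  define N where "N x = A * exp (s * x) + 2 * a * b * (2 * b + a) + B * exp (- s * x)
      - C1 * exp (b * x) - C2 * exp (- a * x)" for x
  define N1 where "N1 x = s * A * exp (s * x) - s * B * exp (- s * x)
      - b * C1 * exp (b * x) + a * C2 * exp (- a * x)" for x
  define N2 where "N2 x = s\<^sup>2 * A * exp (s * x) + s\<^sup>2 * B * exp (- s * x)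
      - b\<^sup>2 * C1 * exp (b * x) - a\<^sup>2 * C2 * exp (- a * x)" for x
  define N3 where "N3 x = s^3 * A * exp (s * x) - s^3 * B * exp (- s * x)
      - b^3 * C1 * exp (b * x) + a^3 * C2 * exp (- a * x)" for x
  have N': "(N has_real_derivative N1 x) (at x within S)" for x S
    unfolding N_def[abs_def] N1_def by (auto intro!: derivative_eq_intros)
  have N1': "(N1 has_real_derivative N2 x) (at x within S)" for x S
    unfolding N1_def[abs_def] N2_def by (auto intro!: derivative_eq_intros simp: power2_eq_square)
  have N2': "(N2 has_real_derivative N3 x) (at x within S)" for x S
    unfolding N2_def[abs_def] N3_def by (auto intro!: derivative_eq_intros simp: power2_eq_square power3_eq_cube)
  \<comment> \<open>In terms of \<open>a\<close> and \<open>d\<close> the polynomials whose signs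
    matter get nonnegative coefficients.\<close>
  obtain d where d: "b = a + d" "0 \<le> d" using ab by (metis add.commute diff_add_cancel diff_ge_0_iff_ge)
  \<comment> \<open>For \<open>N3\<close>, \<open>exp (s * x)\<close> will be lowered to
    \<open>exp (b * x)\<close> and \<open>exp (- s * x)\<close> raised to
    \<open>exp (- a * x)\<close>. What remains has just two exponentials, with the coefficients
    compared here.\<close>
  have P: "0 \<le> s^3 * A - b^3 * C1" and PQ: "s^3 * B - a^3 * C2 \<le> s^3 * A - b^3 * C1"
  proof -
    have "s^3 * A - b^3 * C1 = s * b * ((2*b+a)\<^sup>2 * s\<^sup>2 - 2 * (b + 2*a) * (2*b-a) * b\<^sup>2)"
      unfolding A_def C1_def by (simp add: algebra_simps power2_eq_square power3_eq_cube)
    also have "(2*b+a)\<^sup>2 * s\<^sup>2 - 2 * (b + 2*a) * (2*b-a) * b\<^sup>2 = 6*a*b^3 + 17*a\<^sup>2*b\<^sup>2 + 6*a^3*b + a^4"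
      unfolding s_def by (simp add: algebra_simps power2_eq_square power3_eq_cube power4_eq_xxxx)
    finally show "0 \<le> s^3 * A - b^3 * C1" using ab b s by simp
    have "(s^3 * A - b^3 * C1) - (s^3 * B - a^3 * C2) = 2 * a * s * (s * d) * (2*b\<^sup>2+4*a*b-3*a\<^sup>2)"
      unfolding A_def C1_def B_def C2_def s_def d(1) by (simp add: algebra_simps power2_eq_square power3_eq_cube)
    moreover have "2*b\<^sup>2+4*a*b-3*a\<^sup>2 = 3*a\<^sup>2 + 8*a*d + 2*d\<^sup>2"
      unfolding d(1) by (simp add: algebra_simps power2_eq_square)
    moreover have "0 \<le> 2 * a * s * (s * d) * (3*a\<^sup>2 + 8*a*d + 2*d\<^sup>2)" using ab d s by simp
    ultimately have "0 \<le> (s^3 * A - b^3 * C1) - (s^3 * B - a^3 * C2)" by presburger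
    then show "s^3 * B - a^3 * C2 \<le> s^3 * A - b^3 * C1" by linarith
  qed
  have N3: "0 \<le> N3 x" if x: "0 \<le> x" for x
  proof -
    have e: "exp (b * x) \<le> exp (s * x)" "exp (- s * x) \<le> exp (- a * x)" "exp (- a * x) \<le> exp (b * x)"
      using ab b x by (auto simp: s_def algebra_simps intro: order_trans[of _ 0])
    have AB: "0 \<le> s^3 * A" "0 \<le> s^3 * B" using ab b s by (simp_all add: A_def B_def)
    have "s^3 * A * exp (b * x) - s^3 * B * exp (- a * x) - b^3 * C1 * exp (b * x) + a^3 * C2 * exp (- a * x) \<le> N3 x"
      unfolding N3_def using mult_left_mono[OF e(1) AB(1)] mult_left_mono[OF e(2) AB(2)] by linarith
    moreover have "(s^3 * B - a^3 * C2) * exp (- a * x) \<le> (s^3 * A - b^3 * C1) * exp (- a * x)"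
      using PQ by (intro mult_right_mono) auto
    moreover have "(s^3 * A - b^3 * C1) * exp (- a * x) \<le> (s^3 * A - b^3 * C1) * exp (b * x)"
      using P e(3) by (intro mult_left_mono) auto
    ultimately show ?thesis by (simp add: algebra_simps)
  qed
  \<comment> \<open>The values of \<open>N2\<close>, \<open>N1\<close> and \<open>N\<close> at 0.
    Since \<open>n1\<close> is nonpositive, \<open>N1\<close> need not be nonnegative near 0; the
    quadratic polynomial is therefore treated as a whole, by completing the square.\<close>
  define n2 where "n2 = 2 * s\<^sup>2 * a * (2 * b\<^sup>2 + 7 * a * b - 3 * a\<^sup>2)"
  define n1 where "n1 = - 6 * s\<^sup>2 * a * d"
  define n0 where "n0 = 2 * s\<^sup>2 * d"
  have init: "N 0 = n0" "N1 0 = n1" "N2 0 = n2"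
    unfolding N_def N1_def N2_def n0_def n1_def n2_def A_def B_def C1_def C2_def s_def d(1)
    by (simp_all add: algebra_simps power2_eq_square)
  have N2: "0 \<le> N2 x - n2" if "0 \<le> x" for x
    by (rule nonneg_if_deriv_nonneg[of x "\<lambda>x. N2 x - n2" N3])
       (use that init in \<open>auto intro!: derivative_eq_intros N2' N3\<close>)
  have N1: "0 \<le> N1 x - (n1 + n2 * x)" if "0 \<le> x" for x
    by (rule nonneg_if_deriv_nonneg[of x "\<lambda>x. N1 x - (n1 + n2 * x)" "\<lambda>x. N2 x - n2"])
       (use that init N2 in \<open>auto intro!: derivative_eq_intros N1'\<close>)
  have "0 \<le> N x - (n0 + n1 * x + n2 * x\<^sup>2 / 2)"
    by (rule nonneg_if_deriv_nonneg[of x "\<lambda>x. N x - (n0 + n1 * x + n2 * x\<^sup>2 / 2)" "\<lambda>x. N1 x - (n1 + n2 * x)"])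
       (use x init N1 in \<open>auto intro!: derivative_eq_intros N'\<close>)
  moreover have "0 \<le> n0 + n1 * x + n2 * x\<^sup>2 / 2"
  proof -
    have "n0 + n1 * x + n2 * x\<^sup>2 / 2 = s\<^sup>2 * (2 * d * (1 - 3/2 * (a * x))\<^sup>2 + (6 * a + 13/2 * d) * (a * x)\<^sup>2 + 2 * a * (d * x)\<^sup>2)"
      unfolding n0_def n1_def n2_def d(1) by (simp add: field_simps power2_eq_square)
    then show ?thesis using ab d by simp
  qed
  ultimately have N: "0 \<le> N x" by linarith
  define u v where "u = exp (b * x)" and "v = exp (- a * x)"
  have uv: "0 < u" "0 < v" by (simp_all add: u_def v_def)
  have e: "exp (s * x) = u / v" "exp (- s * x) = v / u"
    by (simp_all add: u_def v_def s_def algebra_simps flip: exp_diff)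
  have "0 \<le> u * v * N x" using N uv by simp
  also have "u * v * N x = A * u\<^sup>2 + 2 * a * b * (2 * b + a) * (u * v) + B * v\<^sup>2 - C1 * u * (u * v) - C2 * v * (u * v)"
    unfolding N_def e using uv unfolding u_def[symmetric] v_def[symmetric]
    by (simp add: field_simps power2_eq_square)
  also have "\<dots> = (2 * b + a) * (2 * (b * u + a * v)\<^sup>2 + a * b * (u - v)\<^sup>2)
     - 2 * (b + 2 * a) * (a + b) * (u * v) * ((2 * b - a) * u + (2 * a - b) * v)"
    unfolding A_def B_def C1_def C2_def s_def by (simp add: algebra_simps power2_eq_square)
  finally show ?thesis by (simp add: u_def v_def)
qed

text \<open>For \<open>b \<le> a\<close> the product of the exponentials is at most 1, hence at most its square root;
  this replacement leaves a homogeneous quartic in the square roots of the exponentials.\<close>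

lemma quad_exp_le:
  fixes a b x :: real
  assumes ab: "0 < b" "b \<le> a" and x: "0 \<le> x"
  shows "2 * (a + b) * (exp (b * x) * exp (- a * x)) * ((2 * b - a) * exp (b * x) + (2 * a - b) * exp (- a * x))
      \<le> 2 * (b * exp (b * x) + a * exp (- a * x))\<^sup>2 + a * b * (exp (b * x) - exp (- a * x))\<^sup>2"
proof -
  define p q where "p = exp (b * x / 2)" and "q = exp (- a * x / 2)"
  have uv: "exp (b * x) = p\<^sup>2" "exp (- a * x) = q\<^sup>2"
    by (simp_all add: p_def q_def power2_eq_square flip: exp_add)
  have pq: "0 < p" "0 < q" "q \<le> p" "p * q \<le> 1"
  proof -
    show "q \<le> p" using ab x by (auto simp: p_def q_def intro: order_trans[of _ 0])
    show "p * q \<le> 1" using ab x by (auto simp: p_def q_def mult_right_mono simp flip: exp_add)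
  qed (simp_all add: p_def q_def)
  define w where "w = (2 * b - a) * p\<^sup>2 + (2 * a - b) * q\<^sup>2"
  have "2 * (a + b) * (p\<^sup>2 * q\<^sup>2) * w \<le> 2 * (b * p\<^sup>2 + a * q\<^sup>2)\<^sup>2 + a * b * (p\<^sup>2 - q\<^sup>2)\<^sup>2" (is "_ \<le> ?r")
  \<comment> \<open>Replacing \<open>p\<^sup>2 * q\<^sup>2\<close> by the larger
    \<open>p * q\<close> enlarges the left side only if \<open>w\<close> is nonnegative; otherwise
    the left side is at most 0 anyway.\<close>
  proof (cases "0 \<le> w")
    case False
    then have "2 * (a + b) * (p\<^sup>2 * q\<^sup>2) * w \<le> 0"
      using ab by (intro mult_nonneg_nonpos) auto
    also have "0 \<le> ?r" using ab by simp
    finally show ?thesis .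
  next
    case True
    have "p\<^sup>2 * q\<^sup>2 \<le> p * q"
      using mult_right_mono[OF pq(4), of "p * q"] pq by (simp add: power2_eq_square algebra_simps)
    then have "2 * (a + b) * (p\<^sup>2 * q\<^sup>2) * w \<le> 2 * (a + b) * (p * q) * w"
      using True ab by (intro mult_right_mono mult_left_mono) auto
    also have "\<dots> \<le> ?r"
    proof -
      \<comment> \<open>The quartics agree at \<open>p = q\<close>, so their difference has the
        factor \<open>y\<close>. The other factor, expanded in \<open>q\<close> and
        \<open>y\<close>, has nonnegative coefficients because \<open>b \<le> a\<close>.\<close>
      obtain y where y: "p = q + y" "0 \<le> y" using pq by (metis add.commute diff_add_cancel diff_ge_0_iff_ge)
      obtain d where d: "a = b + d" "0 \<le> d" using ab by (metis add.commute diff_add_cancel diff_ge_0_iff_ge)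
      have "?r - 2 * (a + b) * (p * q) * w = 2 * y * ((a\<^sup>2 - b\<^sup>2) * q^3 + (3 * a\<^sup>2 + a * b) * q\<^sup>2 * y
          + (a\<^sup>2 + 2 * b\<^sup>2 + a * b) * q * y\<^sup>2 + (b\<^sup>2 + a * b / 2) * y^3)"
        unfolding w_def y(1) by (simp add: field_simps power2_eq_square power3_eq_cube)
      moreover have "0 \<le> 2 * y * ((a\<^sup>2 - b\<^sup>2) * q^3 + (3 * a\<^sup>2 + a * b) * q\<^sup>2 * y
          + (a\<^sup>2 + 2 * b\<^sup>2 + a * b) * q * y\<^sup>2 + (b\<^sup>2 + a * b / 2) * y^3)"
        using y ab pq by (intro mult_nonneg_nonneg add_nonneg_nonneg) auto
      ultimately show ?thesis by linarith
    qed
    finally show ?thesis .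
  qed
  then show ?thesis unfolding uv w_def .
qed

section \<open>The constant \<open>kappa\<close> and the sharpened single-interval estimates\<close>

text \<open>The inner maximum of the norm bound. Passing to \<open>(- l1, - l0)\<close> exchanges
  its two entries; the first is the larger one when \<open>- l0 \<le> l1\<close>, the second when
  \<open>l1 \<le> - l0\<close>.\<close>

definition kappa :: "real \<Rightarrow> real \<Rightarrow> real" where
  "kappa l0 l1 = max ((2 * l1 - 4 * l0) / (- 3 * l0)) ((4 * l1 - 2 * l0) / (3 * l1))"

text \<open>The larger entry is 4/3 plus 2/3 of a ratio that is at least 1, namely the larger of
  \<open>l1\<close> and \<open>- l0\<close> over the smaller.\<close>

lemma kappa_ge_2:
  assumes "l0 < 0" "0 < l1"
  shows "2 \<le> kappa l0 l1"
proof (cases "- l0 \<le> l1")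
  case True
  then have "2 \<le> (2 * l1 - 4 * l0) / (- 3 * l0)" using assms by (simp add: field_simps)
  then show ?thesis by (simp add: kappa_def)
next
  case False
  then have "2 \<le> (4 * l1 - 2 * l0) / (3 * l1)" using assms by (simp add: field_simps)
  then show ?thesis by (simp add: kappa_def)
qed

lemma kappa_reflect: "kappa (- l1) (- l0) = kappa l0 l1"
  by (simp add: kappa_def max.commute algebra_simps)

text \<open>If \<open>- l0 \<le> l1\<close>, then \<open>1 - 1 / kappa l0 l1\<close> is exactly the
  quotient of the constants in \<open>quad_exp_ge\<close>. Otherwise \<open>quad_exp_le\<close>
  gives the factor 1/2, which is enough because \<open>kappa\<close> is at least 2.\<close>

lemma Phi_convolution_le_kappa:
  assumes l: "l0 < 0" "0 < l1" and h: "0 \<le> h"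
  shows "Phi l0 l1 h * integral {0..h} (\<lambda>x. Phi l0 l1 x * Phi (- l1) (- l0) (h - x))
    \<le> (1 - 1 / kappa l0 l1) * Phi (- l1) (- l0) h * integral {0..h} (\<lambda>x. (Phi l0 l1 x)\<^sup>2)"
proof -
  define a b where "a = - l0" and "b = l1"
  have ab: "0 < a" "0 < b" and l_eq: "l0 = - a" "l1 = b" using l by (auto simp: a_def b_def)
  have "Phi (- a) b h * integral {0..h} (\<lambda>x. Phi (- a) b x * Phi (- b) a (h - x))
    \<le> (1 - 1 / kappa (- a) b) * Phi (- b) a h * integral {0..h} (\<lambda>x. (Phi (- a) b x)\<^sup>2)"
  proof (cases "a \<le> b")
    case True
    have "(4 * b + 2 * a) / (3 * b) \<le> (2 * b + 4 * a) / (3 * a)"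
      using ab True by (simp add: field_simps mult_mono)
    then have "kappa (- a) b = (2 * b + 4 * a) / (3 * a)" by (simp add: kappa_def)
    then have k: "1 - 1 / kappa (- a) b = (2 * b + a) / (2 * (b + 2 * a))"
      using ab unfolding \<open>kappa (- a) b = _\<close> by (simp add: field_simps)
    show ?thesis
    proof (rule Phi_convolution_le[OF ab h])
      fix x :: real assume x: "0 \<le> x"
      show "(a + b) * (exp (b * x) * exp (- a * x)) * ((2 * b - a) * exp (b * x) + (2 * a - b) * exp (- a * x))
        \<le> (1 - 1 / kappa (- a) b) * (2 * (b * exp (b * x) + a * exp (- a * x))\<^sup>2 + a * b * (exp (b * x) - exp (- a * x))\<^sup>2)"
        unfolding k using quad_exp_ge[OF ab(1) True x] ab by (simp add: pos_le_divide_eq mult_ac)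
    qed
  next
    case False
    then have False': "b \<le> a" by simp
    have k: "1 / 2 \<le> 1 - 1 / kappa (- a) b"
      using kappa_ge_2[of "- a" b] ab by (simp add: field_simps)
    have half: "X \<le> 1 / 2 * Y" if "2 * X \<le> Y" for X Y :: real
      using that by simp
    show ?thesis
    proof (rule Phi_convolution_le[OF ab h])
      fix x :: real assume x: "0 \<le> x"
      have "(a + b) * (exp (b * x) * exp (- a * x)) * ((2 * b - a) * exp (b * x) + (2 * a - b) * exp (- a * x))
        \<le> 1 / 2 * (2 * (b * exp (b * x) + a * exp (- a * x))\<^sup>2 + a * b * (exp (b * x) - exp (- a * x))\<^sup>2)"
        by (intro half) (use quad_exp_le[OF ab(2) False' x] in \<open>simp only: mult.assoc\<close>)
      also have "\<dots> \<le> (1 - 1 / kappa (- a) b) * (2 * (b * exp (b * x) + a * exp (- a * x))\<^sup>2 + a * b * (exp (b * x) - exp (- a * x))\<^sup>2)"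
        using k ab by (intro mult_right_mono) auto
      finally show "(a + b) * (exp (b * x) * exp (- a * x)) * ((2 * b - a) * exp (b * x) + (2 * a - b) * exp (- a * x))
        \<le> (1 - 1 / kappa (- a) b) * (2 * (b * exp (b * x) + a * exp (- a * x))\<^sup>2 + a * b * (exp (b * x) - exp (- a * x))\<^sup>2)" .
    qed
  qed
  then show ?thesis by (simp add: l_eq)
qed

text \<open>Cleared of denominators, the claim is a product of the convexity inequalities for
  \<open>exp (l1 * x)\<close> and \<open>exp (l0 * x)\<close> on the interval from 0 to \<open>h\<close>.\<close>

lemma Phi_hats_sum_le_1:
  assumes l: "l0 < 0" "0 < l1" and x: "0 \<le> x" "x \<le> h" "0 < h"
  shows "Phi l0 l1 x / Phi l0 l1 h + Phi (- l1) (- l0) (h - x) / Phi (- l1) (- l0) h \<le> 1"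
proof -
  define X Y z w where "X = exp (l1 * h)" and "Y = exp (l1 * x)" and "z = exp (l0 * x)" and "w = exp (l0 * h)"
  have pos: "0 < X" "0 < Y" "0 < z" "0 < w" by (simp_all add: X_def Y_def z_def w_def)
  have Xw: "w < X"
    unfolding X_def w_def using l x by (simp add: mult_strict_right_mono)
  have cvx: "h * exp (l * x) \<le> (h - x) + x * exp (l * h)" for l :: real
  proof -
    have "exp ((1 - x / h) *\<^sub>R 0 + (x / h) *\<^sub>R (l * h)) \<le> (1 - x / h) * exp 0 + x / h * exp (l * h)"
      using x by (intro convex_onD[OF exp_convex]) auto
    then have "h * exp (l * x) \<le> h * ((1 - x / h) + x / h * exp (l * h))"
      using x by (simp add: mult.commute)
    also have "\<dots> = (h - x) + x * exp (l * h)" using x by (simp add: algebra_simps)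
    finally show ?thesis .
  qed
  have "h * Y \<le> (h - x) + x * X"
    using cvx[of l1] by (simp add: X_def Y_def)
  then have 1: "(Y - 1) * (h - x) \<le> (X - Y) * x" by (simp add: algebra_simps)
  have "h * z \<le> (h - x) + x * w"
    using cvx[of l0] by (simp add: z_def w_def)
  then have 2: "(z - w) * x \<le> (1 - z) * (h - x)" by (simp add: algebra_simps)
  have "1 \<le> Y" "z \<le> 1" "w \<le> z" "Y \<le> X"
    using l x by (auto simp: X_def Y_def z_def w_def mult_nonpos_nonneg mult_left_mono mult_left_mono_neg)
  have key: "(Y - 1) * (z - w) \<le> (X - Y) * (1 - z)"
  \<comment> \<open>The two convexity inequalities combine only after multiplication by
    \<open>h - x\<close>, which is cancelled at the end; at \<open>x = h\<close> both sides
    vanish.\<close>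
  proof (cases "x = h")
    case True
    then show ?thesis by (simp add: X_def Y_def z_def w_def)
  next
    case False
    then have hx: "0 < h - x" using x by simp
    have "(h - x) * ((Y - 1) * (z - w)) = ((Y - 1) * (h - x)) * (z - w)" by simp
    also have "\<dots> \<le> ((X - Y) * x) * (z - w)"
      using 1 \<open>w \<le> z\<close> by (intro mult_right_mono) auto
    also have "\<dots> = (X - Y) * ((z - w) * x)" by simp
    also have "\<dots> \<le> (X - Y) * ((1 - z) * (h - x))"
      using 2 \<open>Y \<le> X\<close> by (intro mult_left_mono) auto
    finally have "(h - x) * ((Y - 1) * (z - w)) \<le> (h - x) * ((X - Y) * (1 - z))"
      by (simp add: mult_ac)
    then show ?thesis using hx by simp
  qed
  have r: "Phi l0 l1 x / Phi l0 l1 h = (Y - z) / (X - w)"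
    using l by (simp add: Phi_def X_def Y_def z_def w_def)
  have "exp (- l0 * (h - x)) = z / w" "exp (- l1 * (h - x)) = Y / X" "exp (- l0 * h) = 1 / w" "exp (- l1 * h) = 1 / X"
    by (simp_all add: X_def Y_def z_def w_def right_diff_distrib exp_diff exp_minus inverse_eq_divide)
  then have "Phi (- l1) (- l0) (h - x) / Phi (- l1) (- l0) h = (z / w - Y / X) / (1 / w - 1 / X)"
    using l unfolding Phi_def by simp
  also have "\<dots> = (X * z - Y * w) / (X - w)"
    using pos Xw by (simp add: field_simps)
  finally show ?thesis unfolding r using key Xw by (simp add: field_simps)
qed

section \<open>Rising and falling parts of a hat on one interval\<close>

definition rise :: "real \<Rightarrow> real \<Rightarrow> real \<Rightarrow> real \<Rightarrow> real \<Rightarrow> real" where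
  "rise l0 l1 p q x = Phi l0 l1 (x - p) / Phi l0 l1 (q - p)"

definition fall :: "real \<Rightarrow> real \<Rightarrow> real \<Rightarrow> real \<Rightarrow> real \<Rightarrow> real" where
  "fall l0 l1 p q x = Phi l0 l1 (x - q) / Phi l0 l1 (p - q)"

text \<open>For \<open>p < q\<close> and \<open>x \<le> q\<close> the definition divides two
  nonpositive values; here both are replaced by values of \<open>Phi\<close> at nonnegative
  arguments.\<close>

lemma fall_eq: "fall l0 l1 p q x = Phi (- l1) (- l0) (q - x) / Phi (- l1) (- l0) (q - p)"
  using Phi_reflect[of l0 l1 "q - x"] Phi_reflect[of l0 l1 "q - p"] by (simp add: fall_def)

lemma fall_eq_rise: "fall l0 l1 p q x = rise (- l1) (- l0) (- q) (- p) (- x)"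
  by (simp add: fall_eq rise_def)

lemma rise_eq_fall: "rise l0 l1 p q x = fall (- l1) (- l0) (- q) (- p) (- x)"
  by (simp add: fall_eq_rise)

lemma continuous_on_rise [continuous_intros]: "continuous_on S (rise l0 l1 p q)"
  unfolding rise_def[abs_def] divide_inverse by (intro continuous_intros)

lemma continuous_on_fall [continuous_intros]: "continuous_on S (fall l0 l1 p q)"
  unfolding fall_def[abs_def] divide_inverse by (intro continuous_intros)

lemma rise_left [simp]: "rise l0 l1 p q p = 0"
  by (simp add: rise_def)

lemma fall_right [simp]: "fall l0 l1 p q q = 0"
  by (simp add: fall_def)

context
  fixes l0 l1 p q :: real
  assumes l: "l0 < 0" "0 < l1" and pq: "p < q"
begin

lemma rise_right [simp]: "rise l0 l1 p q q = 1"
  using l pq Phi_pos[of l0 l1 "q - p"] by (simp add: rise_def)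

lemma fall_left [simp]: "fall l0 l1 p q p = 1"
  using l pq Phi_pos[of "- l1" "- l0" "q - p"] by (simp add: fall_eq)

lemma rise_nonneg: "p \<le> x \<Longrightarrow> 0 \<le> rise l0 l1 p q x"
  using l pq by (auto simp: rise_def intro!: divide_nonneg_nonneg Phi_nonneg)

lemma fall_nonneg: "x \<le> q \<Longrightarrow> 0 \<le> fall l0 l1 p q x"
  using l pq by (auto simp: fall_eq intro!: divide_nonneg_nonneg Phi_nonneg)

lemma rise_add_fall_le_1:
  assumes "p \<le> x" "x \<le> q"
  shows "rise l0 l1 p q x + fall l0 l1 p q x \<le> 1"
  using Phi_hats_sum_le_1[OF l, of "x - p" "q - p"] assms pq by (simp add: rise_def fall_eq)

text \<open>A continuous nonnegative function with integral 0 vanishes identically, but the rising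
  part is 1 at \<open>q\<close>.\<close>

lemma integral_rise_pos: "0 < integral {p..q} (rise l0 l1 p q)"
proof -
  have "integral {p..q} (rise l0 l1 p q) \<noteq> 0"
  proof
    assume "integral {p..q} (rise l0 l1 p q) = 0"
    then have "\<forall>x\<in>{p..q}. rise l0 l1 p q x = 0"
      using pq by (subst (asm) integral_eq_0_iff) (auto intro!: continuous_intros rise_nonneg)
    then have "rise l0 l1 p q q = 0" by (rule bspec) (use pq in auto)
    then show False by simp
  qed
  moreover have "0 \<le> integral {p..q} (rise l0 l1 p q)"
    by (intro integral_nonneg integrable_continuous_real continuous_intros) (auto intro: rise_nonneg)
  ultimately show ?thesis by simp
qed

text \<open>Translation to \<open>{0..h}\<close> turns the mixed integral into a convolution of
  \<open>Phi l0 l1\<close> with its reflection. Normalizing the \<open>Phi\<close> inequalities by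
  the end values \<open>P\<close> and \<open>Q\<close> gives both claims.\<close>

lemma integral_rise_fall_le:
  "integral {p..q} (\<lambda>x. rise l0 l1 p q x * fall l0 l1 p q x)
    \<le> (1 - 1 / kappa l0 l1) * integral {p..q} (\<lambda>x. rise l0 l1 p q x * rise l0 l1 p q x)"
  and integral_rise_le: "integral {p..q} (rise l0 l1 p q)
    \<le> 2 * integral {p..q} (\<lambda>x. rise l0 l1 p q x * rise l0 l1 p q x)"
proof -
  define h where "h = q - p"
  have h: "0 < h" using pq by (simp add: h_def)
  have shift: "integral {p..q} g = integral {0..h} (\<lambda>x. g (x + p))" if "continuous_on {p..q} g" for g :: "real \<Rightarrow> real"
    using integral_shift[of 0 p h g] that by (simp add: h_def o_def)
  define P Q where "P = Phi l0 l1 h" and "Q = Phi (- l1) (- l0) h"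
  have PQ: "0 < P" "0 < Q" using l h by (auto simp: P_def Q_def intro!: Phi_pos)
  have "integral {p..q} (\<lambda>x. rise l0 l1 p q x * fall l0 l1 p q x)
      = integral {0..h} (\<lambda>x. 1 / (P * Q) * (Phi l0 l1 x * Phi (- l1) (- l0) (h - x)))"
    using PQ by (subst shift) (auto intro!: continuous_intros integral_cong simp: rise_def fall_eq P_def Q_def h_def algebra_simps)
  then have 1: "integral {p..q} (\<lambda>x. rise l0 l1 p q x * fall l0 l1 p q x)
      = 1 / (P * Q) * integral {0..h} (\<lambda>x. Phi l0 l1 x * Phi (- l1) (- l0) (h - x))" by simp
  have "integral {p..q} (\<lambda>x. rise l0 l1 p q x * rise l0 l1 p q x)
      = integral {0..h} (\<lambda>x. 1 / P\<^sup>2 * (Phi l0 l1 x)\<^sup>2)"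
    using PQ by (subst shift) (auto intro!: continuous_intros integral_cong simp: rise_def P_def h_def power2_eq_square)
  then have 2: "integral {p..q} (\<lambda>x. rise l0 l1 p q x * rise l0 l1 p q x)
      = 1 / P\<^sup>2 * integral {0..h} (\<lambda>x. (Phi l0 l1 x)\<^sup>2)" by simp
  have "integral {p..q} (rise l0 l1 p q) = integral {0..h} (\<lambda>x. 1 / P * Phi l0 l1 x)"
    using PQ by (subst shift) (auto intro!: continuous_intros integral_cong simp: rise_def P_def h_def)
  then have 3: "integral {p..q} (rise l0 l1 p q) = 1 / P * integral {0..h} (Phi l0 l1)" by simp
  have "1 / (P\<^sup>2 * Q) * (P * integral {0..h} (\<lambda>x. Phi l0 l1 x * Phi (- l1) (- l0) (h - x)))
    \<le> 1 / (P\<^sup>2 * Q) * ((1 - 1 / kappa l0 l1) * Q * integral {0..h} (\<lambda>x. (Phi l0 l1 x)\<^sup>2))"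
    using Phi_convolution_le_kappa[OF l, of h] h PQ unfolding P_def Q_def
    by (intro mult_left_mono) auto
  then show "integral {p..q} (\<lambda>x. rise l0 l1 p q x * fall l0 l1 p q x)
    \<le> (1 - 1 / kappa l0 l1) * integral {p..q} (\<lambda>x. rise l0 l1 p q x * rise l0 l1 p q x)"
    unfolding 1 2 using PQ by (simp add: power2_eq_square)
  have "1 / P\<^sup>2 * (P * integral {0..h} (Phi l0 l1)) \<le> 1 / P\<^sup>2 * (2 * integral {0..h} (\<lambda>x. (Phi l0 l1 x)\<^sup>2))"
    using Phi_integral_le_twice_square[OF l, of h] h PQ unfolding P_def
    by (intro mult_left_mono) auto
  then show "integral {p..q} (rise l0 l1 p q)
    \<le> 2 * integral {p..q} (\<lambda>x. rise l0 l1 p q x * rise l0 l1 p q x)"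
    unfolding 2 3 using PQ by (simp add: power2_eq_square)
qed

end

text \<open>The reflection \<open>x\<close> to \<open>- x\<close> carries falling parts to rising
  parts with parameters \<open>(- l1, - l0)\<close> and leaves \<open>kappa\<close>
  unchanged.\<close>

lemma integral_fall_le:
  assumes l: "l0 < 0" "0 < l1" and pq: "p < q"
  shows "0 < integral {p..q} (fall l0 l1 p q)"
    and "integral {p..q} (\<lambda>x. fall l0 l1 p q x * rise l0 l1 p q x)
      \<le> (1 - 1 / kappa l0 l1) * integral {p..q} (\<lambda>x. fall l0 l1 p q x * fall l0 l1 p q x)"
    and "integral {p..q} (fall l0 l1 p q)
      \<le> 2 * integral {p..q} (\<lambda>x. fall l0 l1 p q x * fall l0 l1 p q x)"
proof -
  have l': "- l1 < 0" "0 < - l0" "- q < - p" using l pq by auto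
  have refl: "integral {p..q} (\<lambda>x. g (- x)) = integral {- q..- p} g" for g :: "real \<Rightarrow> real"
    using Henstock_Kurzweil_Integration.integral_reflect_real[of "- p" "- q" g] by simp
  note eqs = fall_eq_rise[of l0 l1 p q] rise_eq_fall[of l0 l1 p q]
  show "0 < integral {p..q} (fall l0 l1 p q)"
    using integral_rise_pos[OF l'] refl[of "rise (- l1) (- l0) (- q) (- p)"] by (simp add: eqs[abs_def])
  show "integral {p..q} (\<lambda>x. fall l0 l1 p q x * rise l0 l1 p q x)
      \<le> (1 - 1 / kappa l0 l1) * integral {p..q} (\<lambda>x. fall l0 l1 p q x * fall l0 l1 p q x)"
    using integral_rise_fall_le[OF l']
      refl[of "\<lambda>x. rise (- l1) (- l0) (- q) (- p) x * fall (- l1) (- l0) (- q) (- p) x"]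
      refl[of "\<lambda>x. rise (- l1) (- l0) (- q) (- p) x * rise (- l1) (- l0) (- q) (- p) x"]
    unfolding kappa_reflect eqs by simp
  show "integral {p..q} (fall l0 l1 p q)
      \<le> 2 * integral {p..q} (\<lambda>x. fall l0 l1 p q x * fall l0 l1 p q x)"
    using integral_rise_le[OF l'] refl[of "rise (- l1) (- l0) (- q) (- p)"]
      refl[of "\<lambda>x. rise (- l1) (- l0) (- q) (- p) x * rise (- l1) (- l0) (- q) (- p) x"]
    by (simp add: eqs[abs_def])
qed

section \<open>Linear algebra and the residual estimate on one interval\<close>

text \<open>Gaussian elimination by induction on the equations: a pivot in equation \<open>a\<close>
  eliminates the unknown \<open>k\<close> from the others, and an equation without a pivot is
  dropped.\<close>

lemma homogeneous_system_nontrivial: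
  fixes s :: "'a \<Rightarrow> 'b \<Rightarrow> 'c :: field"
  assumes "finite A" "finite B" "card A < card B"
  shows "\<exists>d. (\<exists>j\<in>B. d j \<noteq> 0) \<and> (\<forall>i\<in>A. (\<Sum>j\<in>B. s i j * d j) = 0)"
  using assms
proof (induction A arbitrary: B s rule: finite_induct)
  case empty
  then have "B \<noteq> {}" by auto
  then show ?case by (intro exI[of _ "\<lambda>_. 1"]) auto
next
  case (insert a A)
  show ?case
  proof (cases "\<forall>j\<in>B. s a j = 0")
    case True
    then show ?thesis using insert.IH[of B s] insert.prems insert.hyps by auto
  next
    case False
    then obtain k where k: "k \<in> B" "s a k \<noteq> 0" by blast
    define s' where "s' i j = s i j - s i k * s a j / s a k" for i j
    have "card A < card (B - {k})" using insert.prems insert.hyps k by auto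
    then obtain d where d: "\<exists>j\<in>B - {k}. d j \<noteq> 0" "\<forall>i\<in>A. (\<Sum>j\<in>B - {k}. s' i j * d j) = 0"
      using insert.IH[of "B - {k}" s'] insert.prems by auto
    define e where "e = d(k := - (\<Sum>j\<in>B - {k}. s a j * d j) / s a k)"
    have split: "(\<Sum>j\<in>B. s i j * e j) = s i k * e k + (\<Sum>j\<in>B - {k}. s i j * d j)" for i
      using insert.prems k by (subst sum.remove[of _ k]) (auto simp: e_def intro!: sum.cong)
    have "(\<Sum>j\<in>B. s i j * e j) = 0" if "i \<in> insert a A" for i
    proof (cases "i = a")
      case True
      then show ?thesis unfolding split using k by (simp add: e_def)
    next
      case False
      then have "0 = (\<Sum>j\<in>B - {k}. s' i j * d j)" using d that by auto
      also have "\<dots> = (\<Sum>j\<in>B - {k}. s i j * d j) - s i k / s a k * (\<Sum>j\<in>B - {k}. s a j * d j)"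
        by (simp add: s'_def left_diff_distrib sum_subtractf sum_distrib_left mult.assoc)
      finally show ?thesis unfolding split by (simp add: e_def)
    qed
    moreover have "\<exists>j\<in>B. e j \<noteq> 0" using d(1) by (auto simp: e_def)
    ultimately show ?thesis by blast
  qed
qed

text \<open>Here \<open>u\<close> carries a coefficient of largest modulus \<open>m\<close>, made
  positive by \<sigma>, while the neighbour costs at most \<open>m * w\<close>. Multiplying the
  pointwise bound by \<open>u\<close> and using \<open>K\<close> leaves a factor
  \<open>M - m / K\<close> that does not depend on the interval, so that the estimates for the two
  pieces of a hat can be added.\<close>

lemma integral_hat_residual_le:
  fixes u w f :: "real \<Rightarrow> real"
  assumes cont: "continuous_on {p..q} u" "continuous_on {p..q} w" "continuous_on {p..q} f"
    and u: "\<And>x. x \<in> {p..q} \<Longrightarrow> 0 \<le> u x" and w: "\<And>x. x \<in> {p..q} \<Longrightarrow> 0 \<le> w x"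
    and f: "\<And>x. x \<in> {p..q} \<Longrightarrow> \<bar>f x\<bar> \<le> M"
    and K: "0 < K" "integral {p..q} u \<le> K * (integral {p..q} (\<lambda>x. u x * u x) - integral {p..q} (\<lambda>x. u x * w x))"
    and coeffs: "\<bar>\<sigma>\<bar> = 1" "\<sigma> * \<alpha> = m" "\<bar>\<beta>\<bar> \<le> m"
  shows "\<sigma> * integral {p..q} (\<lambda>x. u x * (f x - (\<alpha> * u x + \<beta> * w x))) \<le> (M - m / K) * integral {p..q} u"
proof -
  have m: "0 \<le> m" using coeffs by linarith
  have \<sigma>: "\<bar>\<sigma> * y\<bar> = \<bar>y\<bar>" for y using coeffs(1) by (simp add: abs_mult)
  define I :: "(real \<Rightarrow> real) \<Rightarrow> real" where "I = integral {p..q}"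
  note int = integrable_continuous_real continuous_intros cont
  have "\<sigma> * I (\<lambda>x. u x * (f x - (\<alpha> * u x + \<beta> * w x)))
      = I (\<lambda>x. \<sigma> * (u x * (f x - (\<alpha> * u x + \<beta> * w x))))" by (simp add: I_def)
  also have "\<dots> \<le> I (\<lambda>x. M * u x - m * (u x * u x) + m * (u x * w x))"
    unfolding I_def
  proof (rule integral_le)
    fix x assume x: "x \<in> {p..q}"
    have "- (\<sigma> * \<beta>) * w x \<le> m * w x"
      using \<sigma>[of \<beta>] coeffs(3) w[OF x] by (intro mult_right_mono) linarith+
    then have "- (\<sigma> * \<beta> * w x) \<le> m * w x" by simp
    moreover have "\<sigma> * f x \<le> M" using f[OF x] \<sigma>[of "f x"] by linarith
    ultimately have "\<sigma> * f x - (\<sigma> * \<alpha>) * u x - \<sigma> * \<beta> * w x \<le> M - m * u x + m * w x"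
      unfolding coeffs(2) by linarith
    from mult_left_mono[OF this u[OF x]]
    show "\<sigma> * (u x * (f x - (\<alpha> * u x + \<beta> * w x))) \<le> M * u x - m * (u x * u x) + m * (u x * w x)"
      by (simp add: algebra_simps)
  qed (intro int)+
  also have "\<dots> = M * I u - m * (I (\<lambda>x. u x * u x) - I (\<lambda>x. u x * w x))"
    unfolding I_def by (subst integral_add integral_diff, (intro int)+)+ (simp add: algebra_simps)
  also have "\<dots> \<le> M * I u - m * (I u / K)"
  proof -
    have "I u / K \<le> I (\<lambda>x. u x * u x) - I (\<lambda>x. u x * w x)"
      using K by (simp add: I_def pos_divide_le_eq mult.commute)
    from mult_left_mono[OF this m] show ?thesis by simp
  qed
  finally show ?thesis by (simp add: I_def left_diff_distrib)
qed

section \<open>Hat functions on the whole interval, piece by piece\<close>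

locale hat_system =
  fixes n :: nat and t l0 l1 :: "nat \<Rightarrow> real"
  assumes n: "n \<ge> 3"
    and t_step: "\<And>i. 1 \<le> i \<Longrightarrow> i < n \<Longrightarrow> t i < t (Suc i)"
    and l: "\<And>j. 1 \<le> j \<Longrightarrow> j < n \<Longrightarrow> l0 j < 0" "\<And>j. 1 \<le> j \<Longrightarrow> j < n \<Longrightarrow> 0 < l1 j"
begin

definition "R k = rise (l0 k) (l1 k) (t k) (t (Suc k))"
definition "F k = fall (l0 k) (l1 k) (t k) (t (Suc k))"
abbreviation "H \<equiv> hat n t l0 l1"
abbreviation "piece k \<equiv> {t k..t (Suc k)}"

lemma t_mono:
  assumes "1 \<le> i" "i \<le> j" "j \<le> n"
  shows "t i \<le> t j"
  using assms(2,3)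
proof (induction j rule: dec_induct)
  case (step j)
  then show ?case using t_step[of j] assms(1) by simp
qed simp

lemma t_strict_mono: "1 \<le> i \<Longrightarrow> i < j \<Longrightarrow> j \<le> n \<Longrightarrow> t i < t j"
  using t_step[of i] t_mono[of "Suc i" j] by simp

lemma piece_subset: "1 \<le> k \<Longrightarrow> k < n \<Longrightarrow> piece k \<subseteq> {t 1..t n}"
  using t_mono[of 1 k] t_mono[of "Suc k" n] by auto

lemma continuous_on_R [continuous_intros]: "continuous_on S (R k)"
  unfolding R_def by (intro continuous_intros)

lemma continuous_on_F [continuous_intros]: "continuous_on S (F k)"
  unfolding F_def by (intro continuous_intros)

lemma R_left [simp]: "R k (t k) = 0" and F_right [simp]: "F k (t (Suc k)) = 0"
  by (simp_all add: R_def F_def)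

lemma R_right [simp]: "1 \<le> k \<Longrightarrow> k < n \<Longrightarrow> R k (t (Suc k)) = 1"
  and F_left [simp]: "1 \<le> k \<Longrightarrow> k < n \<Longrightarrow> F k (t k) = 1"
  using l[of k] t_step[of k] by (auto simp: R_def F_def)

lemma R_nonneg: "1 \<le> k \<Longrightarrow> k < n \<Longrightarrow> x \<in> piece k \<Longrightarrow> 0 \<le> R k x"
  and F_nonneg: "1 \<le> k \<Longrightarrow> k < n \<Longrightarrow> x \<in> piece k \<Longrightarrow> 0 \<le> F k x"
  and R_add_F_le_1: "1 \<le> k \<Longrightarrow> k < n \<Longrightarrow> x \<in> piece k \<Longrightarrow> R k x + F k x \<le> 1"
  using l[of k] t_step[of k] by (auto simp: R_def F_def intro!: rise_nonneg fall_nonneg rise_add_fall_le_1)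

lemma hat_eq:
  assumes "1 \<le> i" "i \<le> n"
  shows "H i x = (if 1 < i \<and> x \<in> piece (i - 1) then R (i - 1) x
    else if i < n \<and> x \<in> piece i then F i x else 0)"
  using assms n by (auto simp: hat_def R_def F_def rise_def fall_def numeral_2_eq_2)

text \<open>The formula holds on closed pieces because the one-sided definitions agree at the nodes:
  hats of adjacent pieces that merely touch piece \<open>k\<close> vanish at the common node, and at
  \<open>t k\<close> the rising and falling parts of \<open>H k\<close> are both 1.\<close>

lemma hat_on_piece:
  assumes i: "1 \<le> i" "i \<le> n" and k: "1 \<le> k" "k < n" and x: "x \<in> piece k"
  shows "H i x = (if i = k then F k x else 0) + (if i = Suc k then R k x else 0)"
proof -
  consider "Suc i < k" | "Suc i = k" | "i = k" | "i = Suc k" | "i = Suc (Suc k)" | "Suc (Suc k) < i" by linarith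
  then show ?thesis
  proof cases
    case 1
    then have "t (Suc i) < t k" "t i \<le> t (Suc i)" using t_strict_mono t_mono i k by simp_all
    then show ?thesis using 1 x i by (simp add: hat_eq)
  next
    case 2
    then have "t i < t k" using t_strict_mono i k by simp
    then show ?thesis using 2 x i F_right[of i] by (auto simp: hat_eq dest: antisym)
  next
    case 3
    then show ?thesis using x i k R_right[of "k - 1"] by (auto simp: hat_eq dest: antisym)
  next
    case 4
    then show ?thesis using x i k by (auto simp: hat_eq)
  next
    case 5
    then have "t (Suc k) < t i" using t_strict_mono i k by simp
    then show ?thesis using 5 x i by (auto simp: hat_eq dest: antisym)
  next
    case 6
    then have "t (Suc k) < t (i - 1)" "t (i - 1) \<le> t i" using t_strict_mono t_mono i k by simp_all
    then show ?thesis using 6 x i by (simp add: hat_eq)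
  qed
qed

lemma continuous_on_pieces:
  fixes g :: "real \<Rightarrow> real"
  assumes "1 \<le> m" "m \<le> n" "\<And>k. 1 \<le> k \<Longrightarrow> k < m \<Longrightarrow> continuous_on (piece k) g"
  shows "continuous_on {t 1..t m} g"
  using assms
proof (induction m rule: dec_induct)
  case (step m)
  have "{t 1..t (Suc m)} = {t 1..t m} \<union> piece m"
    using t_mono[of 1 m] t_step[of m] step by auto
  then show ?case using step by (auto intro!: continuous_on_closed_Un)
qed simp

lemma integral_pieces:
  fixes g :: "real \<Rightarrow> real"
  assumes "1 \<le> m" "m \<le> n" "continuous_on {t 1..t n} g"
  shows "integral {t 1..t m} g = (\<Sum>k=1..<m. integral (piece k) g)"
  using assms(1,2)
proof (induction m rule: dec_induct)
  case (step m)
  have "g integrable_on {t 1..t (Suc m)}"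
    using assms(3) t_mono[of "Suc m" n] step
    by (intro integrable_continuous_real) (auto intro: continuous_on_subset)
  then have "integral {t 1..t m} g + integral (piece m) g = integral {t 1..t (Suc m)} g"
    using t_mono[of 1 m] t_step[of m] step by (intro Henstock_Kurzweil_Integration.integral_combine) auto
  then show ?case using step by simp
qed simp

lemma continuous_on_hat:
  assumes "1 \<le> i" "i \<le> n"
  shows "continuous_on {t 1..t n} (H i)"
proof (rule continuous_on_pieces)
  fix k assume k: "1 \<le> k" "k < n"
  have "continuous_on (piece k) (\<lambda>x. (if i = k then F k x else 0) + (if i = Suc k then R k x else 0))"
    by (cases "i = k"; cases "i = Suc k") (auto intro!: continuous_intros)
  then show "continuous_on (piece k) (H i)"
    by (rule continuous_on_eq) (use hat_on_piece[OF assms k] in simp)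
qed (use n in auto)

lemma integral_hat_mult:
  fixes g :: "real \<Rightarrow> real"
  assumes i: "1 \<le> i" "i \<le> n" and g: "continuous_on {t 1..t n} g"
  shows "integral {t 1..t n} (\<lambda>x. H i x * g x) =
    (if i < n then integral (piece i) (\<lambda>x. F i x * g x) else 0) +
    (if 1 < i then integral (piece (i - 1)) (\<lambda>x. R (i - 1) x * g x) else 0)"
proof -
  have "integral {t 1..t n} (\<lambda>x. H i x * g x) = (\<Sum>k=1..<n. integral (piece k) (\<lambda>x. H i x * g x))"
    using n i by (intro integral_pieces continuous_intros continuous_on_hat g) auto
  also have "\<dots> = (\<Sum>k=1..<n. (if k = i then integral (piece k) (\<lambda>x. F k x * g x) else 0)
      + (if k = i - 1 then integral (piece k) (\<lambda>x. R k x * g x) else 0))"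
  proof (rule sum.cong[OF refl])
    fix k assume "k \<in> {1..<n}"
    then have k: "1 \<le> k" "k < n" by auto
    have "integral (piece k) (\<lambda>x. H i x * g x)
      = integral (piece k) (\<lambda>x. ((if i = k then F k x else 0) + (if i = Suc k then R k x else 0)) * g x)"
      by (intro integral_cong) (simp add: hat_on_piece[OF i k])
    also have "\<dots> = (if k = i then integral (piece k) (\<lambda>x. F k x * g x) else 0)
      + (if k = i - 1 then integral (piece k) (\<lambda>x. R k x * g x) else 0)"
      using i k by (cases "i = k"; cases "i = Suc k") auto
    finally show "integral (piece k) (\<lambda>x. H i x * g x) = \<dots>" .
  qed
  also have "\<dots> = (if i < n then integral (piece i) (\<lambda>x. F i x * g x) else 0) +
    (if 1 < i then integral (piece (i - 1)) (\<lambda>x. R (i - 1) x * g x) else 0)"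
    using i by (auto simp: sum.distrib sum.delta)
  finally show ?thesis .
qed

lemma hat_combination_on_piece:
  assumes k: "1 \<le> k" "k < n" and x: "x \<in> piece k"
  shows "(\<Sum>j=1..n. c j * H j x) = c k * F k x + c (Suc k) * R k x"
proof -
  have "(\<Sum>j=1..n. c j * H j x) = (\<Sum>j=1..n. (if j = k then c k * F k x else 0) + (if j = Suc k then c (Suc k) * R k x else 0))"
    using hat_on_piece[OF _ _ k x] by (intro sum.cong) auto
  then show ?thesis using k by (simp add: sum.distrib sum.delta)
qed

lemma continuous_on_hat_combination: "continuous_on {t 1..t n} (\<lambda>x. \<Sum>j=1..n. c j * H j x)"
  by (intro continuous_intros continuous_on_hat) auto

section \<open>Diagonal dominance, existence and uniqueness of the projection, norm bound\<close>

context
  fixes K :: real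
  assumes K: "\<And>k. 1 \<le> k \<Longrightarrow> k < n \<Longrightarrow> kappa (l0 k) (l1 k) \<le> K"
begin

lemma K_ge_2: "2 \<le> K"
  using kappa_ge_2[OF l(1)[of 1] l(2)[of 1]] K[of 1] n by simp

text \<open>To be read with \<open>A\<close>, \<open>C\<close>, \<open>X\<close> as the integrals of
  \<open>u * u\<close>, \<open>u * w\<close> and \<open>u\<close>. Enlarging \<kappa> to
  \<open>K\<close> weakens the first estimate, which then says \<open>A \<le> K * (A - C)\<close>;
  combine this with \<open>X \<le> 2 * A\<close>.\<close>

lemma piece_dominance_aux:
  fixes A C X \<kappa> :: real
  assumes "2 \<le> \<kappa>" "\<kappa> \<le> K" "C \<le> (1 - 1 / \<kappa>) * A" "0 < X" "X \<le> 2 * A"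
  shows "C \<le> (1 - 1 / K) * A" "X \<le> 2 * K * (A - C)"
proof -
  have A: "0 < A" using assms by linarith
  have "1 / K \<le> 1 / \<kappa>" using assms by (simp add: frac_le)
  then have "(1 - 1 / \<kappa>) * A \<le> (1 - 1 / K) * A" using A by (intro mult_right_mono) auto
  with assms show C: "C \<le> (1 - 1 / K) * A" by linarith
  then have "A / K \<le> A - C" by (simp add: left_diff_distrib)
  then have "A \<le> K * (A - C)" using assms by (simp add: pos_divide_le_eq mult.commute)
  with assms show "X \<le> 2 * K * (A - C)" by linarith
qed

lemma piece_dominance:
  assumes k: "1 \<le> k" "k < n"
  shows "integral (piece k) (\<lambda>x. R k x * F k x) \<le> (1 - 1 / K) * integral (piece k) (\<lambda>x. R k x * R k x)"
    "integral (piece k) (R k) \<le> 2 * K * (integral (piece k) (\<lambda>x. R k x * R k x) - integral (piece k) (\<lambda>x. R k x * F k x))"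
    "integral (piece k) (\<lambda>x. F k x * R k x) \<le> (1 - 1 / K) * integral (piece k) (\<lambda>x. F k x * F k x)"
    "integral (piece k) (F k) \<le> 2 * K * (integral (piece k) (\<lambda>x. F k x * F k x) - integral (piece k) (\<lambda>x. F k x * R k x))"
    "0 < integral (piece k) (R k)"
    "0 < integral (piece k) (F k)"
  using piece_dominance_aux[OF kappa_ge_2[OF l(1)[OF k] l(2)[OF k]] K[OF k]
      integral_rise_fall_le[OF l(1)[OF k] l(2)[OF k] t_step[OF k]]
      integral_rise_pos[OF l(1)[OF k] l(2)[OF k] t_step[OF k]]
      integral_rise_le[OF l(1)[OF k] l(2)[OF k] t_step[OF k]]]
    piece_dominance_aux[OF kappa_ge_2[OF l(1)[OF k] l(2)[OF k]] K[OF k]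
      integral_fall_le(2,1,3)[OF l(1)[OF k] l(2)[OF k] t_step[OF k]]]
    integral_fall_le(1)[OF l(1)[OF k] l(2)[OF k] t_step[OF k]]
    integral_rise_pos[OF l(1)[OF k] l(2)[OF k] t_step[OF k]]
  unfolding R_def F_def by blast+

text \<open>Stated for arbitrary coefficients with orthogonal residual, so that it can precede
  existence. With \<open>f = 0\<close> and \<open>M = 0\<close> it says that the normal equations
  have only the trivial homogeneous solution.\<close>

lemma orthogonal_coefficient_bound:
  assumes f: "continuous_on {t 1..t n} f" and M: "\<And>x. x \<in> {t 1..t n} \<Longrightarrow> \<bar>f x\<bar> \<le> M"
    and orth: "\<And>i. 1 \<le> i \<Longrightarrow> i \<le> n \<Longrightarrow>
      integral {t 1..t n} (\<lambda>x. H i x * (f x - (\<Sum>j=1..n. c j * H j x))) = 0"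
    and i: "1 \<le> i" "i \<le> n"
  shows "\<bar>c i\<bar> \<le> 2 * K * M"
proof -
  have "Max ((\<lambda>j. \<bar>c j\<bar>) ` {1..n}) \<in> (\<lambda>j. \<bar>c j\<bar>) ` {1..n}"
    using n by (intro Max_in) auto
  then obtain m where m: "1 \<le> m" "m \<le> n" and m_max: "Max ((\<lambda>j. \<bar>c j\<bar>) ` {1..n}) = \<bar>c m\<bar>" by auto
  have c_le: "\<bar>c j\<bar> \<le> \<bar>c m\<bar>" if "1 \<le> j" "j \<le> n" for j
    unfolding m_max[symmetric] using that by (intro Max_ge) auto
  \<comment> \<open>Unlike \<open>sgn\<close>, this is 1 at 0, so its modulus is always 1.\<close>
  define \<sigma> :: real where "\<sigma> = (if c m < 0 then - 1 else 1)"
  have \<sigma>: "\<bar>\<sigma>\<bar> = 1" "\<sigma> * c m = \<bar>c m\<bar>" by (auto simp: \<sigma>_def)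
  define g where "g x = f x - (\<Sum>j=1..n. c j * H j x)" for x
  have g: "continuous_on {t 1..t n} g"
    unfolding g_def[abs_def] by (intro continuous_intros f continuous_on_hat_combination)
  \<comment> \<open>Both pieces of \<open>H m\<close> give this same factor, so orthogonality yields
    \<open>0 \<le> q * w\<close> with \<open>w\<close> the positive integral of \<open>H m\<close>.
    Then \<open>0 \<le> q\<close> is the desired bound on \<open>c m\<close>.\<close>
  define q where "q = M - \<bar>c m\<bar> / (2 * K)"
  have K0: "0 < 2 * K" using K_ge_2 by simp
  have left: "\<sigma> * integral (piece m) (\<lambda>x. F m x * g x) \<le> q * integral (piece m) (F m)" if "m < n"
  proof -
    have "integral (piece m) (\<lambda>x. F m x * g x)
      = integral (piece m) (\<lambda>x. F m x * (f x - (c m * F m x + c (Suc m) * R m x)))"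
      unfolding g_def using m that by (intro integral_cong) (simp add: hat_combination_on_piece del: One_nat_def)
    also have "\<sigma> * \<dots> \<le> q * integral (piece m) (F m)"
      unfolding q_def
      using m that piece_subset[of m] M c_le[of "Suc m"] piece_dominance(4)[of m]
      by (intro integral_hat_residual_le continuous_intros continuous_on_subset[OF f] F_nonneg R_nonneg K0 \<sigma>) auto
    finally show ?thesis .
  qed
  have right: "\<sigma> * integral (piece k) (\<lambda>x. R k x * g x) \<le> q * integral (piece k) (R k)" if k: "1 \<le> k" "m = Suc k" for k
  proof -
    have "integral (piece k) (\<lambda>x. R k x * g x)
      = integral (piece k) (\<lambda>x. R k x * (f x - (c m * R k x + c k * F k x)))"
      unfolding g_def using m k by (intro integral_cong) (simp add: hat_combination_on_piece algebra_simps del: One_nat_def)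
    also have "\<sigma> * \<dots> \<le> q * integral (piece k) (R k)"
      unfolding q_def
      using m k piece_subset[of k] M c_le[of k] piece_dominance(2)[of k]
      by (intro integral_hat_residual_le continuous_intros continuous_on_subset[OF f] F_nonneg R_nonneg K0 \<sigma>) auto
    finally show ?thesis .
  qed
  have zero: "(if m < n then integral (piece m) (\<lambda>x. F m x * g x) else 0) +
    (if 1 < m then integral (piece (m - 1)) (\<lambda>x. R (m - 1) x * g x) else 0) = 0"
    using integral_hat_mult[OF m g] orth[OF m] by (simp add: g_def)
  define w where "w = (if m < n then integral (piece m) (F m) else 0) +
    (if 1 < m then integral (piece (m - 1)) (R (m - 1)) else 0)"
  have "0 < w"
    using piece_dominance(5)[of "m - 1"] piece_dominance(6)[of m] m n by (auto simp: w_def intro: add_pos_pos)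
  have "0 = \<sigma> * ((if m < n then integral (piece m) (\<lambda>x. F m x * g x) else 0) +
    (if 1 < m then integral (piece (m - 1)) (\<lambda>x. R (m - 1) x * g x) else 0))"
    unfolding zero by simp
  also have "\<dots> \<le> q * w"
    unfolding w_def distrib_left using left right[of "m - 1"] m by (intro add_mono) auto
  finally have "0 \<le> q" using \<open>0 < w\<close> by (simp add: zero_le_mult_iff)
  then have "\<bar>c m\<bar> \<le> 2 * K * M"
    using K0 by (simp add: q_def pos_divide_le_eq mult.commute)
  with c_le[OF i] show ?thesis by simp
qed

lemma gram_eq:
  assumes "1 \<le> i" "i \<le> n" "1 \<le> j" "j \<le> n"
  shows "gram n t l0 l1 i j =
    (if i < n then integral (piece i) (\<lambda>x. F i x * H j x) else 0) +
    (if 1 < i then integral (piece (i - 1)) (\<lambda>x. R (i - 1) x * H j x) else 0)"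
  unfolding gram_def using assms by (intro integral_hat_mult continuous_on_hat)

lemma integral_piece_cong_hat:
  assumes "1 \<le> k" "k < n" "1 \<le> j" "j \<le> n"
  shows "integral (piece k) (\<lambda>x. u x * H j x) =
    (if j = k then integral (piece k) (\<lambda>x. u x * F k x) else 0) +
    (if j = Suc k then integral (piece k) (\<lambda>x. u x * R k x) else 0)"
proof -
  have "integral (piece k) (\<lambda>x. u x * H j x)
    = integral (piece k) (\<lambda>x. u x * ((if j = k then F k x else 0) + (if j = Suc k then R k x else 0)))"
    using assms by (intro integral_cong) (simp add: hat_on_piece)
  then show ?thesis by (cases "j = k"; cases "j = Suc k") auto
qed

lemma gram_diag:
  assumes "1 \<le> j" "j \<le> n"
  shows "gram n t l0 l1 j j = (if 1 < j then integral (piece (j - 1)) (\<lambda>x. R (j - 1) x * R (j - 1) x) else 0)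
    + (if j < n then integral (piece j) (\<lambda>x. F j x * F j x) else 0)"
proof (cases j)
  case (Suc k)
  have "1 \<le> k \<Longrightarrow> integral (piece k) (\<lambda>x. R k x * H (Suc k) x) = integral (piece k) (\<lambda>x. R k x * R k x)"
    using assms Suc by (subst integral_piece_cong_hat) auto
  moreover have "Suc k < n \<Longrightarrow> integral (piece (Suc k)) (\<lambda>x. F (Suc k) x * H (Suc k) x)
      = integral (piece (Suc k)) (\<lambda>x. F (Suc k) x * F (Suc k) x)"
    using assms by (subst integral_piece_cong_hat) auto
  ultimately show ?thesis
    unfolding gram_eq[OF assms assms] unfolding Suc by (cases "1 \<le> k"; cases "Suc k < n") simp_all
qed (use assms in simp)

lemma gram_off_diag:
  assumes "1 \<le> j" "j < n"
  shows "gram n t l0 l1 j (Suc j) = integral (piece j) (\<lambda>x. F j x * R j x)"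
  using assms by (cases j) (auto simp: gram_eq integral_piece_cong_hat)

text \<open>Each off-diagonal entry lives on one piece and is compared with the part of the diagonal
  entry on that piece: the left neighbour with the square of the rising part, the right one with
  that of the falling part.\<close>

lemma row_diag_dominant_gram: "row_diag_dominant (gram n t l0 l1) n"
  unfolding row_diag_dominant_def
proof (intro exI[of _ "1 - 1 / K"] conjI ballI)
  show "0 < 1 - 1 / K" "1 - 1 / K < 1" using K_ge_2 by auto
  fix j assume "j \<in> {1..n}"
  then have j: "1 \<le> j" "j \<le> n" by auto
  have off: "0 \<le> integral (piece k) (\<lambda>x. F k x * R k x)" if "1 \<le> k" "k < n" for k
    using that F_nonneg R_nonneg
    by (intro integral_nonneg integrable_continuous_real continuous_intros mult_nonneg_nonneg)
  have "(if j = 1 then 0 else \<bar>gram n t l0 l1 (j - 1) j\<bar>) \<le> (1 - 1 / K) *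
      (if 1 < j then integral (piece (j - 1)) (\<lambda>x. R (j - 1) x * R (j - 1) x) else 0)"
  proof (cases "j = 1")
    case False
    then obtain k where k: "j = Suc k" "1 \<le> k" "k < n" using j by (cases j) auto
    then show ?thesis
      using gram_off_diag[of k] off[of k] piece_dominance(1)[of k] by (simp add: mult.commute)
  qed simp
  moreover have "(if j = n then 0 else \<bar>gram n t l0 l1 j (j + 1)\<bar>) \<le> (1 - 1 / K) *
      (if j < n then integral (piece j) (\<lambda>x. F j x * F j x) else 0)"
    using gram_off_diag[of j] off[of j] piece_dominance(3)[of j] j by simp
  moreover have "(1 - 1 / K) * gram n t l0 l1 j j \<le> (1 - 1 / K) * \<bar>gram n t l0 l1 j j\<bar>"
    using \<open>0 < 1 - 1 / K\<close> by (intro mult_left_mono) auto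
  ultimately show "(if j = 1 then 0 else \<bar>gram n t l0 l1 (j - 1) j\<bar>) + (if j = n then 0 else \<bar>gram n t l0 l1 j (j + 1)\<bar>)
      \<le> (1 - 1 / K) * \<bar>gram n t l0 l1 j j\<bar>"
    unfolding gram_diag[OF j] distrib_left by linarith
qed

text \<open>Translates orthogonality of the residual into the normal equations of the Gram
  matrix.\<close>

lemma integral_residual:
  assumes f: "continuous_on {t 1..t n} f" and i: "1 \<le> i" "i \<le> n"
  shows "integral {t 1..t n} (\<lambda>x. H i x * (f x - (\<Sum>j=1..n. c j * H j x)))
    = integral {t 1..t n} (\<lambda>x. H i x * f x) - (\<Sum>j=1..n. c j * gram n t l0 l1 i j)"
proof -
  note int = integrable_continuous_real continuous_intros continuous_on_hat f
  have "integral {t 1..t n} (\<lambda>x. H i x * (f x - (\<Sum>j=1..n. c j * H j x)))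
    = integral {t 1..t n} (\<lambda>x. H i x * f x - (\<Sum>j=1..n. c j * (H i x * H j x)))"
    by (simp add: right_diff_distrib sum_distrib_left mult_ac)
  also have "\<dots> = integral {t 1..t n} (\<lambda>x. H i x * f x) - integral {t 1..t n} (\<lambda>x. \<Sum>j=1..n. c j * (H i x * H j x))"
    using i by (intro integral_diff int) auto
  also have "integral {t 1..t n} (\<lambda>x. \<Sum>j=1..n. c j * (H i x * H j x))
      = (\<Sum>j=1..n. integral {t 1..t n} (\<lambda>x. c j * (H i x * H j x)))"
    using i by (intro integral_sum int) auto
  finally show ?thesis by (simp add: gram_def)
qed

text \<open>The right-hand side is adjoined as column 0, giving \<open>n\<close> homogeneous
  equations in \<open>n + 1\<close> unknowns. In a nontrivial solution \<open>d 0\<close> is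
  nonzero, since otherwise the coefficient bound for the zero function kills all other entries;
  dividing by \<open>d 0\<close> solves the normal equations.\<close>

lemma orthogonal_coefficients_exist:
  assumes f: "continuous_on {t 1..t n} f"
  obtains c where "\<And>i. 1 \<le> i \<Longrightarrow> i \<le> n \<Longrightarrow>
    integral {t 1..t n} (\<lambda>x. H i x * (f x - (\<Sum>j=1..n. c j * H j x))) = 0"
proof -
  define s where "s i j = (if j = 0 then - integral {t 1..t n} (\<lambda>x. H i x * f x) else gram n t l0 l1 i j)" for i j
  obtain d where d: "\<exists>j\<in>{0..n}. d j \<noteq> 0" "\<forall>i\<in>{1..n}. (\<Sum>j\<in>{0..n}. s i j * d j) = 0"
    using homogeneous_system_nontrivial[of "{1..n}" "{0..n}" s] by auto
  have sys: "(\<Sum>j=1..n. d j * gram n t l0 l1 i j) = d 0 * integral {t 1..t n} (\<lambda>x. H i x * f x)"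
    if "1 \<le> i" "i \<le> n" for i
  proof -
    have "(\<Sum>j\<in>{0..n}. s i j * d j) = s i 0 * d 0 + (\<Sum>j=1..n. s i j * d j)"
      by (simp add: sum.atLeast_Suc_atMost)
    moreover have "(\<Sum>j=1..n. s i j * d j) = (\<Sum>j=1..n. d j * gram n t l0 l1 i j)"
      by (intro sum.cong) (auto simp: s_def)
    ultimately show ?thesis using d(2) that by (simp add: s_def)
  qed
  have "d 0 \<noteq> 0"
  proof
    assume d0: "d 0 = 0"
    have "d j = 0" if "1 \<le> j" "j \<le> n" for j
      using orthogonal_coefficient_bound[of "\<lambda>_. 0" 0 d j] integral_residual[of "\<lambda>_. 0" _ d] sys d0 that
      by simp
    with d(1) d0 show False by (metis atLeastAtMost_iff less_one linorder_not_less)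
  qed
  have "integral {t 1..t n} (\<lambda>x. H i x * (f x - (\<Sum>j=1..n. d j / d 0 * H j x))) = 0"
    if i: "1 \<le> i" "i \<le> n" for i
  proof -
    have "(\<Sum>j=1..n. d j / d 0 * gram n t l0 l1 i j) = (\<Sum>j=1..n. d j * gram n t l0 l1 i j) / d 0"
      by (simp add: sum_divide_distrib)
    then show ?thesis
      using sys[OF i] \<open>d 0 \<noteq> 0\<close> unfolding integral_residual[OF f i] by simp
  qed
  then show ?thesis by (rule that)
qed

text \<open>The description by \<open>THE\<close> asks for equality of functions on the whole real
  line. It follows because the coefficients themselves coincide: their differences have residual
  orthogonality for the zero function, so they are bounded by 0.\<close>

lemma hat_proj_eq:
  assumes f: "continuous_on {t 1..t n} f"
    and orth: "\<And>i. 1 \<le> i \<Longrightarrow> i \<le> n \<Longrightarrow>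
      integral {t 1..t n} (\<lambda>x. H i x * (f x - (\<Sum>j=1..n. c j * H j x))) = 0"
  shows "hat_proj n t l0 l1 f = (\<lambda>x. \<Sum>j=1..n. c j * H j x)"
  unfolding hat_proj_def
proof (rule the_equality, intro conjI ballI)
  show "(\<lambda>x. \<Sum>j=1..n. c j * H j x) \<in> hat_span n t l0 l1"
    by (auto simp: hat_span_def)
  show "integral {t 1..t n} (\<lambda>x. (f x - (\<Sum>j=1..n. c j * H j x)) * H i x) = 0" if "i \<in> {1..n}" for i
    using orth[of i] that by (simp add: mult.commute)
next
  fix g assume g: "g \<in> hat_span n t l0 l1 \<and> (\<forall>i\<in>{1..n}. integral {t 1..t n} (\<lambda>x. (f x - g x) * H i x) = 0)"
  then obtain d where d: "g = (\<lambda>x. \<Sum>j=1..n. d j * H j x)" by (auto simp: hat_span_def)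
  have orth': "integral {t 1..t n} (\<lambda>x. H i x * (f x - (\<Sum>j=1..n. d j * H j x))) = 0" if "1 \<le> i" "i \<le> n" for i
    using g that by (simp add: d mult.commute)
  have "integral {t 1..t n} (\<lambda>x. H i x * (0 - (\<Sum>j=1..n. (d j - c j) * H j x))) = 0" if i: "1 \<le> i" "i \<le> n" for i
    using orth[OF i] orth'[OF i] integral_residual[of "\<lambda>_. 0" i "\<lambda>j. d j - c j"] i
    unfolding integral_residual[OF f i] by (simp add: left_diff_distrib sum_subtractf)
  then have "\<bar>d j - c j\<bar> \<le> 2 * K * 0" if "1 \<le> j" "j \<le> n" for j
    using that by (intro orthogonal_coefficient_bound[of "\<lambda>_. 0" 0 "\<lambda>j. d j - c j" j]) auto
  then have "d j = c j" if "j \<in> {1..n}" for j using that by auto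
  then show "g = (\<lambda>x. \<Sum>j=1..n. c j * H j x)" unfolding d by (auto intro!: sum.cong)
qed

lemma exists_piece:
  assumes "x \<in> {t 1..t n}"
  obtains k where "1 \<le> k" "k < n" "x \<in> piece k"
proof -
  have "\<exists>k. 1 \<le> k \<and> k < m \<and> x \<in> piece k" if "2 \<le> m" "x \<le> t m" for m
    using that
  proof (induction m rule: dec_induct)
    case base
    then show ?case using assms by (intro exI[of _ 1]) (auto simp: numeral_2_eq_2)
  next
    case (step m)
    show ?case
    proof (cases "x \<le> t m")
      case True
      then show ?thesis using step.IH less_SucI by blast
    next
      case False
      then show ?thesis using step by (intro exI[of _ m]) auto
    qed
  qed
  from this[of n] show ?thesis using n assms that by auto
qed

lemma abs_hat_proj_le:
  assumes f: "continuous_on {t 1..t n} f" and M: "\<And>x. x \<in> {t 1..t n} \<Longrightarrow> \<bar>f x\<bar> \<le> M"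
    and x: "x \<in> {t 1..t n}"
  shows "\<bar>hat_proj n t l0 l1 f x\<bar> \<le> 2 * K * M"
proof -
  obtain c where c: "\<And>i. 1 \<le> i \<Longrightarrow> i \<le> n \<Longrightarrow>
    integral {t 1..t n} (\<lambda>x. H i x * (f x - (\<Sum>j=1..n. c j * H j x))) = 0"
    using orthogonal_coefficients_exist[OF f] by blast
  obtain k where k: "1 \<le> k" "k < n" "x \<in> piece k" using exists_piece[OF x] .
  have bound: "\<bar>c i\<bar> \<le> 2 * K * M" if "1 \<le> i" "i \<le> n" for i
    using orthogonal_coefficient_bound[OF f M c that] .
  \<comment> \<open>Needed because \<open>R k x + F k x\<close> may be strictly less than 1.\<close>
  have "0 \<le> 2 * K * M" using bound[of 1] n by simp
  have "\<bar>hat_proj n t l0 l1 f x\<bar> = \<bar>c k * F k x + c (Suc k) * R k x\<bar>"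
    by (simp only: hat_proj_eq[where c = c, OF f c] hat_combination_on_piece[OF k])
  also have "\<dots> \<le> \<bar>c k\<bar> * F k x + \<bar>c (Suc k)\<bar> * R k x"
    using F_nonneg[OF k] R_nonneg[OF k] abs_triangle_ineq[of "c k * F k x" "c (Suc k) * R k x"]
    by (simp add: abs_mult)
  also have "\<dots> \<le> 2 * K * M * F k x + 2 * K * M * R k x"
    using F_nonneg[OF k] R_nonneg[OF k] k by (intro add_mono mult_right_mono bound) auto
  also have "\<dots> = 2 * K * M * (R k x + F k x)" by (simp add: algebra_simps)
  also have "\<dots> \<le> 2 * K * M"
    using mult_left_mono[OF R_add_F_le_1[OF k] \<open>0 \<le> 2 * K * M\<close>] by simp
  finally show ?thesis .
qed

end

end

theorem mainTheorem18:
  fixes n :: nat and t l0 l1 :: "nat \<Rightarrow> real"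
  assumes "n \<ge> 3"
    and "\<forall>i\<in>{1..<n}. t i < t (i + 1)"
    and "\<forall>j\<in>{1..n-1}. l0 j < 0 \<and> 0 < l1 j"
  shows "row_diag_dominant (gram n t l0 l1) n \<and>
    (\<forall>f M. continuous_on {t 1 .. t n} f \<longrightarrow> (\<forall>x\<in>{t 1 .. t n}. \<bar>f x\<bar> \<le> M) \<longrightarrow>
       (\<forall>x\<in>{t 1 .. t n}. \<bar>hat_proj n t l0 l1 f x\<bar> \<le>
          2 * Max ((\<lambda>j. max ((2 * l1 j - 4 * l0 j) / (- 3 * l0 j))
                                ((4 * l1 j - 2 * l0 j) / (3 * l1 j))) ` {1..n-1}) * M))"
proof -
  interpret hat_system n t l0 l1
    using assms by unfold_locales auto
  define K where "K = Max ((\<lambda>j. kappa (l0 j) (l1 j)) ` {1..n-1})"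
  have K: "kappa (l0 k) (l1 k) \<le> K" if "1 \<le> k" "k < n" for k
    unfolding K_def using that by (intro Max_ge) auto
  have "\<forall>f M. continuous_on {t 1..t n} f \<longrightarrow> (\<forall>x\<in>{t 1..t n}. \<bar>f x\<bar> \<le> M) \<longrightarrow>
       (\<forall>x\<in>{t 1..t n}. \<bar>hat_proj n t l0 l1 f x\<bar> \<le> 2 * K * M)"
    using abs_hat_proj_le[OF K] by blast
  with row_diag_dominant_gram[OF K] show ?thesis
    unfolding K_def kappa_def by blast
qed

end
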